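(* Let the data set $\mathcal D$ be generated according to the sampling scheme (DATA), let $\beta\in(0,1)$ be a probabilistic tolerance, and suppose that the projection-error bound (PROJ) holds, with $d_0\in\mathbb N$ and the constants $c_x,c_u$ chosen as in (CERT). Suppose $d\ge d_0$, that the discrete-time robust control contraction metric condition (RCCM) and the terminal condition (TERM) hold for the model learned from $\mathcal D$, and that the tube MPC problem $\mathcal P(x(k))$ is feasible at time $k=0$. Consider the closed loop $x(k+1)=F(x(k),u(k))$, $u(k)=\kappa(x(k),\bar x^*_{0|k},\bar u^*_{0|k})$ generated by the online algorithm (ALG). Then, with probability at least $1-\beta$ with respect to $\mathcal D$, $\mathcal P(x(k))$ is feasible for all $k\ge0$, the original constraints are satisfied, $$(x(k),u(k))\in\mathcal Z\quad\forall k\ge0,$$ and $$\lim_{k\to\infty}\|x(k)\|=0.$$ In particular, if the terminal ingredients are $k_f(\bar x)\equiv0_{n_u}$, $\ell_f(\bar x,\delta)=\frac{\lambda}{\rho_c}\delta^2$ and $\mathcal X_f=\{(\bar x,\delta)\in\mathbb R^{n_x}\times\mathbb R_{\ge0}\mid\bar x=0_{n_x},\ h_j(\bar x,k_f(\bar x))+c_j\delta\le0\ \forall j\in\{1,\dots,n_h\}\}$, then the closed-loop system is exponentially stable on $\mathcal X_N$, where $\mathcal X_N$ is the set of initial states for which the tube MPC problem is feasible.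
   Context: Exponentially stable on $\mathcal X_N$ means: there exist constants $C>0$ and $\sigma\in(0,1)$ such that $\|x(k)\|\le C\sigma^k\|x(0)\|$ for all $k\ge0$ and all $x(0)\in\mathcal X_N$. Notation: $\|\cdot\|$ is the Euclidean norm, $\|y\|_P=\sqrt{y^\top P y}$, $\mathcal B(y,r)$ is the closed ball, $\otimes$ the Kronecker product, $\preceq$ the Loewner order, $\mathbb S_+^n$ the symmetric positive definite $n\times n$ matrices, $\|\cdot\|_F$ the Frobenius norm; $P^{1/2}$ is the Cholesky factor with $P=(P^{1/2})^\top P^{1/2}$ and $P^{-1/2}$ its inverse. System. $\mathbb X\subset\mathbb R^{n_x}$ and $\mathbb U\subset\mathbb R^{n_u}$ are compact, and $\mathbb U$ contains the standard basis vectors $e_1,\dots,e_{n_u}$. The true system is $\dot x=f(x)+g(x)u$ with $f(0)=0$; $x(t;\hat x,u)$ is its solution at time $t$ from $\hat x$ under constant input $u$ (provided it exists), $T_s>0$ is fixed, and $F(x,u)=x(T_s;x,u)$ is the sampled true map. The constraint set $\mathcal Z=\{(x,u)\in\mathbb R^{n_x}\times\mathbb R^{n_u}\mid h_j(x,u)\le0,\ j=1,\dots,n_h\}\subseteq\mathbb X\times\mathbb U$ is compact, each $h_j$ is continuously differentiable and $h_j(0,0)<0$. Lifting. $\Phi(x)=[1\ \hat\Phi(x)^\top]^\top$, $\hat\Phi(x)=[x^\top\ \phi_{n_x+1}(x)\cdots\phi_{n_z}(x)]^\top\in\mathbb R^{n_z}$, $n_z>n_x$, with continuously differentiable $\phi_\ell:\mathbb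 R^{n_x}\to\mathbb R$, $\phi_\ell(0)=0$. (DATA) Let $\mu_{\mathbb X}$ be the normalized Lebesgue probability measure on $\mathbb X$. For each $\tilde u\in\{0,e_1,\dots,e_{n_u}\}$, the states $x_1^{\tilde u},\dots,x_d^{\tilde u}$ are drawn i.i.d. according to $\mu_{\mathbb X}$, independently across $\tilde u$, and $y_j^{\tilde u}=F(x_j^{\tilde u},\tilde u)$; $\mathcal D$ is the collection of all pairs $(x_j^{\tilde u},y_j^{\tilde u})$. Probabilities are with respect to $\mu_{\mathbb X}^{\otimes d(1+n_u)}$. Learned model. $A,B_i\in\mathbb R^{n_z\times n_z}$, $b_i\in\mathbb R^{n_z}$ are least-squares fits: $A$ minimizes $\|[\hat\Phi(y_1^0)\cdots\hat\Phi(y_d^0)]-A[\hat\Phi(x_1^0)\cdots\hat\Phi(x_d^0)]\|_F$, and $[b_i\ B_i]$ minimizes $\|[\hat\Phi(y_1^{e_i})\cdots\hat\Phi(y_d^{e_i})]-[b_i\ B_i][\Phi(x_1^{e_i})\cdots\Phi(x_d^{e_i})]\|_F$. Put $B_0=[b_1\cdots b_{n_u}]$, $\mathcal L(x,u)=A\hat\Phi(x)+B_0u+\sum_{i=1}^{n_u}(B_i-A)u_i\hat\Phi(x)$, $\xi(x,u)=\hat\Phi(F(x,u))-\mathcal L(x,u)$, and $\hat F(x,u)=[I_{n_x}\ 0_{n_x\times(n_z-n_x)}]\,\mathcal L(x,u)$. (PROJ) Let $(\mathcal K^u_{T_s}\phi)(x)=\phi(x(T_s;x,u))$ be the Koopman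 operator on $L^2(\mathbb X,\mu_{\mathbb X})$ (applied componentwise to vector functions), let $\mathbb V$ be the span of the components of $\Phi$ and $P_{\mathbb V}$ the $L^2(\mathbb X,\mu_{\mathbb X})$-orthogonal projection onto $\mathbb V$. There are constants $\tilde c_x,\tilde c_u\ge 0$ with $\|(\mathcal K^u_{T_s}\Phi)(x)-(P_{\mathbb V}\mathcal K^u_{T_s}|_{\mathbb V}\Phi)(x)\|\le\tilde c_x\|\hat\Phi(x)\|+\tilde c_u\|u\|$ for all $x\in\mathbb X$, $u\in\mathbb U$. (CERT) Known result (SafEDMD error certificate, from the literature): under (PROJ), for any $\beta\in(0,1)$, $d_0\in\mathbb N$, $T_s>0$ there exist constants $\bar c_x,\bar c_u\in\mathcal O(1/\sqrt{\beta d_0}+T_s^2)$ such that, with $c_x=\tilde c_x+\bar c_x$ and $c_u=\tilde c_u+\bar c_u$ (nonnegative), for all $d\ge d_0$ the bound $\|\xi(x,u)\|\le c_x\|\hat\Phi(x)\|+c_u\|u\|$ for all $x\in\mathbb X$, $u\in\mathbb U$ holds with probability $1-\beta$. The constants $c_x,c_u$ used throughout are such constants. Uncertain predictor. $E(x,u)=[c_x(\hat\Phi(x)^\top\otimes I_{n_x})\ \ c_u(u^\top\otimes I_{n_x})]$; $\mathbb D$ is the set of vectors $\begin{bmatrix}w_\Phi\otimes w_x\\ w_u\otimes w_x\end{bmatrix}$ with $w_\Phi\in\mathcal B(0_{n_z},1)$, $w_u\in\mathcal B(0_{n_u},1)$, $w_x\in\mathcal B(0_{n_x},1)$; and $f_w(x,u,w)=\hat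 F(x,u)+E(x,u)w$. (RCCM): $M:\mathbb R^{n_x}\to\mathbb S_+^{n_x}$ is continuously differentiable, $K:\mathbb R^{n_x}\to\mathbb R^{n_u\times n_x}$ is continuous, $0<\rho_c<1$, $\alpha_1,\alpha_2>0$, and for all $(x,u)\in\mathcal Z$, $w\in\mathbb D$, with $x_+=f_w(x,u,w)$ and $A_{cl}(x,u,w)=\frac{\partial f_w}{\partial x}(x,u,w)+\frac{\partial f_w}{\partial u}(x,u,w)K(x)$: $A_{cl}^\top M(x_+)A_{cl}\preceq(1-\rho_c)M(x)$, $\alpha_1I\preceq M(x)\preceq\alpha_2I$, and $M(x_+)\preceq\alpha_2I$. Distance and feedback. $\Gamma(\bar x,x)$ is the set of componentwise continuously differentiable curves $\gamma:[0,1]\to\mathbb R^{n_x}$ with $\gamma(0)=\bar x$, $\gamma(1)=x$. $V(x,\bar x)=\min_{\gamma\in\Gamma(\bar x,x)}\int_0^1\|\dot\gamma(s)\|_{M(\gamma(s))}ds$ is the Riemannian distance, $\gamma^*$ denotes a minimizer (geodesic, taken to exist). $\gamma^u(s)=\bar u+\int_0^sK(\gamma^*(s'))\dot\gamma^*(s')ds'$ and $\kappa(x,\bar x,\bar u)=\gamma^u(1)$. Tightening constants: $c_j=\max_{(x,u)\in\mathcal Z}\|(\frac{\partial h_j}{\partial x}(x,u)+\frac{\partial h_j}{\partial u}(x,u)K(x))M(x)^{-1/2}\|$. Stage cost: $\ell(\bar x,\bar u,\delta)=\|\bar x\|_Q^2+\|\bar u\|_R^2+\lambda\delta^2$, $Q\in\mathbb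 S_+^{n_x}$, $R\in\mathbb S_+^{n_u}$, $\lambda>0$. (TERM): there are $\mathcal X_f\subseteq\mathbb R^{n_x}\times\mathbb R_{\ge0}$, $k_f:\mathbb R^{n_x}\to\mathbb R^{n_u}$, $\ell_f:\mathbb R^{n_x}\times\mathbb R_{\ge0}\to\mathbb R_{\ge0}$ such that for every $(\bar x,\delta)\in\mathcal X_f$ and all $j$, with $\bar x_+=\hat F(\bar x,k_f(\bar x))$ and $\delta_+=\sqrt{1-\rho_c}\,\delta+\sqrt{\alpha_2}(c_x\|\hat\Phi(\bar x)\|+c_u\|k_f(\bar x)\|)$: $(\bar x_+,\delta_+)\in\mathcal X_f$; $h_j(\bar x,k_f(\bar x))+c_j\delta\le0$ and $h_j(\bar x_+,k_f(\bar x_+))+c_j\delta_+\le0$; $\ell(\bar x,k_f(\bar x),\delta)\le\ell_f(\bar x,\delta)-\ell_f(\bar x_+,\delta_+)$; and for $\hat\delta\in[0,\delta]$, $(\bar x,\hat\delta)\in\mathcal X_f$ and $\ell_f(\bar x,\hat\delta)\le\ell_f(\bar x,\delta)$. Tube MPC problem $\mathcal P(x(k))$ (horizon $N$): minimize $\sum_{i=0}^{N-1}\ell(\bar x_{i|k},\bar u_{i|k},\delta_{i|k})+\ell_f(\bar x_{N|k},\delta_{N|k})$ over $\bar x_{\cdot|k},\bar u_{\cdot|k},\delta_{\cdot|k}$ subject to, for $i=0,\dots,N-1$ and $j=1,\dots,n_h$: $\bar x_{i+1|k}=\hat F(\bar x_{i|k},\bar u_{i|k})$; $\delta_{i+1|k}=\sqrt{1-\rho_c}\,\delta_{i|k}+\sqrt{\alpha_2}(c_x\|\hat\Phi(\bar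 x_{i|k})\|+c_u\|\bar u_{i|k}\|)$; $h_j(\bar x_{i|k},\bar u_{i|k})+c_j\delta_{i|k}\le0$; $V(x(k),\bar x_{0|k})=\delta_{0|k}$; $(\bar x_{N|k},\delta_{N|k})\in\mathcal X_f$. (ALG) At each time $k$: the candidate is initialized as some feasible solution of $\mathcal P(x(0))$ if $k=0$, and as the shifted previous solution if $k\ge1$; a numerical solver is run on $\mathcal P(x(k))$ for a limited time, and if it finds a feasible solution with smaller cost the candidate is replaced by it (no optimality is required); then, if the local solution $\bar x_{i|k}=0$, $\bar u_{i|k}=0$, $\delta_{i|k}=(\sqrt{1-\rho_c})^iV(x(k),0)$, $i=0,\dots,N$, is feasible and has smaller cost, the candidate is replaced by it. The resulting candidate is the returned solution (denoted with $*$), and $u(k)=\kappa(x(k),\bar x^*_{0|k},\bar u^*_{0|k})$ is applied. The shifted previous solution at time $k+1$ is: $\bar x_{0|k+1}=\bar x^*_{1|k}$, $\delta_{0|k+1}=V(x(k+1),\bar x_{0|k+1})$, $\bar u_{i|k+1}=\bar u^*_{i+1|k}$ for $i=0,\dots,N-1$, where $\bar u^*_{N|k}:=k_f(\bar x^*_{N|k})$, with the remaining $\bar x_{i|k+1},\delta_{i|k+1}$ given by the two recursions of $\mathcal P$.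
   Formalization: Added assumption: whenever the tightening constant c_j is 0, the row ∂h_j/∂x + (∂h_j/∂u)K vanishes on an open neighbourhood of Z, not only on Z; without it the claim (x(k),u(k)) ∈ Z can fail. *)

theory Defs
  imports "HOL-Analysis.Analysis"
begin

section \<open>Matrices and differentiation\<close>

definition psd :: "real^'n^'n \<Rightarrow> bool" where
  "psd P \<longleftrightarrow> transpose P = P \<and> (\<forall>v. 0 \<le> v \<bullet> (P *v v))"

definition pd :: "real^'n^'n \<Rightarrow> bool" where
  "pd P \<longleftrightarrow> transpose P = P \<and> (\<forall>v. v \<noteq> 0 \<longrightarrow> 0 < v \<bullet> (P *v v))"

definition loewner_le :: "real^'n^'n \<Rightarrow> real^'n^'n \<Rightarrow> bool" where
  "loewner_le P P' \<longleftrightarrow> psd (P' - P)"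

definition wnorm :: "real^'n^'n \<Rightarrow> real^'n \<Rightarrow> real" where
  "wnorm P y = sqrt (y \<bullet> (P *v y))"

(* Types are written (real, 'n) vec where 'n also needs an order, since ^ fixes the sort to finite.
   The upper triangular L with positive diagonal and P = L^T L is unique for positive definite P. *)
definition chol :: "((real, 'n::{finite,linorder}) vec, 'n) vec \<Rightarrow> ((real, 'n) vec, 'n) vec" where
  "chol P = (SOME L. (\<forall>i j. j < i \<longrightarrow> L $ i $ j = 0) \<and> (\<forall>i. 0 < L $ i $ i) \<and> P = transpose L ** L)"

(* Kronecker product of the row vector v^T with A; columns are indexed by pairs. *)
definition kron_row :: "real^'a \<Rightarrow> real^'b^'r \<Rightarrow> real^('a \<times> 'b)^'r" where
  "kron_row v A = (\<chi> r q. v $ fst q * A $ r $ snd q)"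

definition kron_vec :: "real^'a \<Rightarrow> real^'b \<Rightarrow> real^('a \<times> 'b)" where
  "kron_vec v w = (\<chi> q. v $ fst q * w $ snd q)"

definition hblock :: "real^'a^'r \<Rightarrow> real^'b^'r \<Rightarrow> real^('a + 'b)^'r" where
  "hblock A B = (\<chi> r c. case c of Inl a \<Rightarrow> A $ r $ a | Inr b \<Rightarrow> B $ r $ b)"

definition vstack :: "real^'a \<Rightarrow> real^'b \<Rightarrow> real^('a + 'b)" where
  "vstack v w = (\<chi> c. case c of Inl a \<Rightarrow> v $ a | Inr b \<Rightarrow> w $ b)"

(* Frobenius norm of the matrix with columns c 0, ..., c (d - 1). *)
definition frob_cols :: "nat \<Rightarrow> (nat \<Rightarrow> real^'a) \<Rightarrow> real" where
  "frob_cols d c = sqrt (\<Sum>j<d. \<Sum>i\<in>UNIV. (c j $ i)\<^sup>2)"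

definition cont_diff :: "('a::euclidean_space \<Rightarrow> 'b::real_normed_vector) \<Rightarrow> bool" where
  "cont_diff F \<longleftrightarrow> (\<forall>p. F differentiable (at p)) \<and>
     (\<forall>v. continuous_on UNIV (\<lambda>p. frechet_derivative F (at p) v))"

definition grad :: "(real^'n \<Rightarrow> real) \<Rightarrow> real^'n \<Rightarrow> real^'n" where
  "grad F x = (\<chi> i. frechet_derivative F (at x) (axis i 1))"


section \<open>Sampled control-affine system and lifting\<close>

(* Dimensions: n_x = CARD('n), n_u = CARD('m), n_h = CARD('c) and n_z = CARD('n) + CARD('l) > n_x;
   \<open>obs l\<close> are the observables appended to the state. *)
record ('n, 'm, 'l, 'c) plant =
  fdyn :: "real^('n::finite) \<Rightarrow> real^'n"
  gdyn :: "real^'n \<Rightarrow> real^('m::finite)^'n"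
  Ts   :: real
  Xset :: "(real^'n) set"
  Uset :: "(real^'m) set"
  hcon :: "('c::finite) \<Rightarrow> (real^'n) \<times> (real^'m) \<Rightarrow> real"
  obs  :: "('l::finite) \<Rightarrow> real^'n \<Rightarrow> real"

definition is_solution ::
  "('n::finite, 'm::finite, 'l::finite, 'c::finite) plant \<Rightarrow> real^'m \<Rightarrow> real^'n \<Rightarrow> real \<Rightarrow> (real \<Rightarrow> real^'n) \<Rightarrow> bool"
where
  "is_solution pb u x0 T y \<longleftrightarrow> y 0 = x0 \<and>
     (\<forall>t\<in>{0..T}. (y has_vector_derivative (fdyn pb (y t) + gdyn pb (y t) *v u)) (at t within {0..T}))"

definition flow_at ::
  "('n::finite, 'm::finite, 'l::finite, 'c::finite) plant \<Rightarrow> real \<Rightarrow> real^'n \<Rightarrow> real^'m \<Rightarrow> real^'n" where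
  "flow_at pb t x0 u = (THE z. \<exists>y. is_solution pb u x0 t y \<and> y t = z)"

definition Fmap ::
  "('n::finite, 'm::finite, 'l::finite, 'c::finite) plant \<Rightarrow> real^'n \<Rightarrow> real^'m \<Rightarrow> real^'n" where
  "Fmap pb x u = flow_at pb (Ts pb) x u"

(* Makes the definite description in \<open>flow_at\<close> meaningful wherever the sampled map is used. *)
definition sampled_flow_exists :: "('n::finite, 'm::finite, 'l::finite, 'c::finite) plant \<Rightarrow> bool" where
  "sampled_flow_exists pb \<longleftrightarrow>
     (\<forall>x\<in>Xset pb. \<forall>u\<in>Uset pb. \<exists>!z. \<exists>y. is_solution pb u x (Ts pb) y \<and> y (Ts pb) = z)"

definition Zset :: "('n::finite, 'm::finite, 'l::finite, 'c::finite) plant \<Rightarrow> ((real^'n) \<times> (real^'m)) set" where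
  "Zset pb = {p. \<forall>j. hcon pb j p \<le> 0}"

definition system_ok :: "('n::finite, 'm::finite, 'l::finite, 'c::finite) plant \<Rightarrow> bool" where
  "system_ok pb \<longleftrightarrow>
     compact (Xset pb) \<and> compact (Uset pb) \<and> (\<forall>i. axis i 1 \<in> Uset pb) \<and>
     fdyn pb 0 = 0 \<and> 0 < Ts pb \<and> sampled_flow_exists pb \<and>
     Zset pb \<subseteq> Xset pb \<times> Uset pb \<and> compact (Zset pb) \<and>
     (\<forall>j. cont_diff (hcon pb j) \<and> hcon pb j (0, 0) < 0)"

definition Phihat ::
  "('n::finite, 'm::finite, 'l::finite, 'c::finite) plant \<Rightarrow> real^'n \<Rightarrow> real^('n + 'l)" where
  "Phihat pb x = vstack x (\<chi> l. obs pb l x)"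

(* Component None is the constant observable 1. *)
definition Phi ::
  "('n::finite, 'm::finite, 'l::finite, 'c::finite) plant \<Rightarrow> real^'n \<Rightarrow> real^(('n + 'l) option)" where
  "Phi pb x = (\<chi> a. case a of None \<Rightarrow> 1 | Some b \<Rightarrow> Phihat pb x $ b)"

definition lifting_ok :: "('n::finite, 'm::finite, 'l::finite, 'c::finite) plant \<Rightarrow> bool" where
  "lifting_ok pb \<longleftrightarrow> (\<forall>l. cont_diff (obs pb l) \<and> obs pb l 0 = 0)"


section \<open>Random data and the learned bilinear model\<close>

definition muX :: "('n::finite, 'm::finite, 'l::finite, 'c::finite) plant \<Rightarrow> (real^'n) measure" where
  "muX pb = uniform_measure (lebesgue_on (Xset pb)) (Xset pb)"

(* The input experiments 0, e_1, ..., e_{n_u} are indexed by None, Some i; a draw assigns to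
   (experiment, j) with j < d the sampled state x_j. *)
type_synonym ('n, 'm) draw = "'m option \<times> nat \<Rightarrow> real^'n"

definition exp_input :: "'m option \<Rightarrow> real^('m::finite)" where
  "exp_input e = (case e of None \<Rightarrow> 0 | Some i \<Rightarrow> axis i 1)"

definition data_measure ::
  "('n::finite, 'm::finite, 'l::finite, 'c::finite) plant \<Rightarrow> nat \<Rightarrow> ('n, 'm) draw measure" where
  "data_measure pb d = PiM (UNIV \<times> {..<d}) (\<lambda>_. muX pb)"

(* The witness event S avoids any measurability requirement on P. *)
definition holds_with_prob :: "'a measure \<Rightarrow> real \<Rightarrow> ('a \<Rightarrow> bool) \<Rightarrow> bool" where
  "holds_with_prob M p P \<longleftrightarrow> (\<exists>S\<in>sets M. p \<le> measure M S \<and> (\<forall>\<omega>\<in>S. P \<omega>))"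

(* \<open>Gmat i\<close> is the block matrix [b_i B_i]; \<open>cx\<close>, \<open>cu\<close> are the error-bound constants. *)
record ('n, 'm, 'l) model =
  Amat :: "real^(('n::finite) + ('l::finite))^('n + 'l)"
  Gmat :: "('m::finite) \<Rightarrow> real^(('n + 'l) option)^('n + 'l)"
  cx :: real
  cu :: real

definition bvec :: "('n::finite, 'm::finite, 'l::finite) model \<Rightarrow> 'm \<Rightarrow> real^('n + 'l)" where
  "bvec md i = (\<chi> r. Gmat md i $ r $ None)"

definition Bmat :: "('n::finite, 'm::finite, 'l::finite) model \<Rightarrow> 'm \<Rightarrow> real^('n + 'l)^('n + 'l)" where
  "Bmat md i = (\<chi> r c. Gmat md i $ r $ Some c)"

definition B0mat :: "('n::finite, 'm::finite, 'l::finite) model \<Rightarrow> real^'m^('n + 'l)" where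
  "B0mat md = (\<chi> r i. bvec md i $ r)"

definition least_squares_fit ::
  "('n::finite, 'm::finite, 'l::finite, 'c::finite) plant \<Rightarrow> nat \<Rightarrow> ('n, 'm) draw \<Rightarrow>
   ('n, 'm, 'l) model \<Rightarrow> bool" where
  "least_squares_fit pb d \<omega> md \<longleftrightarrow>
     (let xs = (\<lambda>e j. \<omega> (e, j)); ys = (\<lambda>e j. Fmap pb (\<omega> (e, j)) (exp_input e)) in
      is_arg_min (\<lambda>A. frob_cols d (\<lambda>j. Phihat pb (ys None j) - A *v Phihat pb (xs None j)))
        (\<lambda>_. True) (Amat md) \<and>
      (\<forall>i. is_arg_min (\<lambda>G. frob_cols d (\<lambda>j. Phihat pb (ys (Some i) j) - G *v Phi pb (xs (Some i) j)))
        (\<lambda>_. True) (Gmat md i)))"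

definition Lmap ::
  "('n::finite, 'm::finite, 'l::finite, 'c::finite) plant \<Rightarrow> ('n, 'm, 'l) model \<Rightarrow>
   real^'n \<Rightarrow> real^'m \<Rightarrow> real^('n + 'l)" where
  "Lmap pb md x u = Amat md *v Phihat pb x + B0mat md *v u
     + (\<Sum>i\<in>UNIV. (u $ i) *\<^sub>R ((Bmat md i - Amat md) *v Phihat pb x))"

definition xi ::
  "('n::finite, 'm::finite, 'l::finite, 'c::finite) plant \<Rightarrow> ('n, 'm, 'l) model \<Rightarrow>
   real^'n \<Rightarrow> real^'m \<Rightarrow> real^('n + 'l)" where
  "xi pb md x u = Phihat pb (Fmap pb x u) - Lmap pb md x u"

definition Fhat ::
  "('n::finite, 'm::finite, 'l::finite, 'c::finite) plant \<Rightarrow> ('n, 'm, 'l) model \<Rightarrow>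
   real^'n \<Rightarrow> real^'m \<Rightarrow> real^'n" where
  "Fhat pb md x u = hblock (mat 1) 0 *v Lmap pb md x u"


section \<open>Projection error and error certificate\<close>

definition square_integrable :: "'a measure \<Rightarrow> ('a \<Rightarrow> real) \<Rightarrow> bool" where
  "square_integrable \<mu> \<psi> \<longleftrightarrow> \<psi> \<in> borel_measurable \<mu> \<and> integrable \<mu> (\<lambda>x. (\<psi> x)\<^sup>2)"

(* \<open>p\<close> is a pointwise representative, taken in \<open>V\<close>, of the orthogonal projection of \<open>\<psi>\<close>. *)
definition is_L2_projection ::
  "'a measure \<Rightarrow> ('a \<Rightarrow> real) set \<Rightarrow> ('a \<Rightarrow> real) \<Rightarrow> ('a \<Rightarrow> real) \<Rightarrow> bool" where
  "is_L2_projection \<mu> V \<psi> p \<longleftrightarrow> square_integrable \<mu> \<psi> \<and> p \<in> V \<and>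
     (\<forall>v\<in>V. (\<integral>x. (\<psi> x - p x) * v x \<partial>\<mu>) = 0)"

definition Vspan :: "('n::finite, 'm::finite, 'l::finite, 'c::finite) plant \<Rightarrow> (real^'n \<Rightarrow> real) set" where
  "Vspan pb = {\<lambda>x. \<Sum>a\<in>UNIV. c $ a * Phi pb x $ a | c. True}"

definition koopman ::
  "('n::finite, 'm::finite, 'l::finite, 'c::finite) plant \<Rightarrow> real \<Rightarrow> real^'m \<Rightarrow>
   (real^'n \<Rightarrow> real) \<Rightarrow> real^'n \<Rightarrow> real" where
  "koopman pb t u \<phi> = (\<lambda>x. \<phi> (flow_at pb t x u))"

definition projection_bound ::
  "('n::finite, 'm::finite, 'l::finite, 'c::finite) plant \<Rightarrow> real \<Rightarrow> real \<Rightarrow> bool" where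
  "projection_bound pb ctx ctu \<longleftrightarrow> 0 \<le> ctx \<and> 0 \<le> ctu \<and>
     (\<forall>u\<in>Uset pb. \<exists>p.
        (\<forall>a. is_L2_projection (muX pb) (Vspan pb) (koopman pb (Ts pb) u (\<lambda>x. Phi pb x $ a)) (p a)) \<and>
        (\<forall>x\<in>Xset pb.
           norm ((\<chi> a. koopman pb (Ts pb) u (\<lambda>x. Phi pb x $ a) x) - (\<chi> a. p a x))
             \<le> ctx * norm (Phihat pb x) + ctu * norm u))"

(* cb (beta, d0, T_s) is of order 1 / sqrt (beta d0) + T_s^2. *)
definition certificate_rate :: "(real \<Rightarrow> nat \<Rightarrow> real \<Rightarrow> real) \<Rightarrow> bool" where
  "certificate_rate cb \<longleftrightarrow> (\<exists>C. \<forall>\<beta> d0 \<tau>. 0 < \<beta> \<and> \<beta> < 1 \<and> 0 < d0 \<and> 0 < \<tau> \<longrightarrow>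
     \<bar>cb \<beta> d0 \<tau>\<bar> \<le> C * (1 / sqrt (\<beta> * real d0) + \<tau>\<^sup>2))"

definition error_certificate ::
  "('n::finite, 'm::finite, 'l::finite, 'c::finite) plant \<Rightarrow>
   (nat \<Rightarrow> ('n, 'm) draw \<Rightarrow> ('n, 'm, 'l) model) \<Rightarrow> real \<Rightarrow> nat \<Rightarrow> bool" where
  "error_certificate pb learned \<beta> d0 \<longleftrightarrow>
     (\<forall>d\<ge>d0. holds_with_prob (data_measure pb d) (1 - \<beta>)
        (\<lambda>\<omega>. \<forall>x\<in>Xset pb. \<forall>u\<in>Uset pb.
           norm (xi pb (learned d \<omega>) x u)
             \<le> cx (learned d \<omega>) * norm (Phihat pb x) + cu (learned d \<omega>) * norm u))"


section \<open>Uncertain predictor and contraction metric\<close>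

type_synonym ('n, 'm, 'l) disturbance = "real^((('n + 'l) \<times> 'n) + ('m \<times> 'n))"

definition Emat ::
  "('n::finite, 'm::finite, 'l::finite, 'c::finite) plant \<Rightarrow> ('n, 'm, 'l) model \<Rightarrow>
   real^'n \<Rightarrow> real^'m \<Rightarrow> real^((('n + 'l) \<times> 'n) + ('m \<times> 'n))^'n" where
  "Emat pb md x u =
     hblock (cx md *\<^sub>R kron_row (Phihat pb x) (mat 1)) (cu md *\<^sub>R kron_row u (mat 1))"

definition Dset :: "('n::finite, 'm::finite, 'l::finite) disturbance set" where
  "Dset = {vstack (kron_vec wp wx) (kron_vec wu wx) | wp wu wx.
     wp \<in> cball 0 1 \<and> wu \<in> cball 0 1 \<and> wx \<in> cball 0 1}"

definition fw ::
  "('n::finite, 'm::finite, 'l::finite, 'c::finite) plant \<Rightarrow> ('n, 'm, 'l) model \<Rightarrow>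
   real^'n \<Rightarrow> real^'m \<Rightarrow> ('n, 'm, 'l) disturbance \<Rightarrow> real^'n" where
  "fw pb md x u w = Fhat pb md x u + Emat pb md x u *v w"

(* \<open>geo xb x\<close> selects the geodesic from xb to x that the feedback integrates along. *)
record ('n, 'm) design =
  Mmet :: "real^('n::finite) \<Rightarrow> real^'n^'n"
  Kfb  :: "real^'n \<Rightarrow> real^'n^('m::finite)"
  rho  :: real
  alpha1 :: real
  alpha2 :: real
  geo  :: "real^'n \<Rightarrow> real^'n \<Rightarrow> real \<Rightarrow> real^'n"
  Qmat :: "real^'n^'n"
  Rmat :: "real^'m^'m"
  lam  :: real
  kf   :: "real^'n \<Rightarrow> real^'m"
  lf   :: "real^'n \<Rightarrow> real \<Rightarrow> real"
  Xf   :: "((real^'n) \<times> real) set"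
  hor  :: nat

definition Acl ::
  "('n::finite, 'm::finite, 'l::finite, 'c::finite) plant \<Rightarrow> ('n, 'm, 'l) model \<Rightarrow> ('n, 'm) design \<Rightarrow>
   real^'n \<Rightarrow> real^'m \<Rightarrow> ('n, 'm, 'l) disturbance \<Rightarrow> real^'n^'n" where
  "Acl pb md ds x u w = jacobian (\<lambda>x'. fw pb md x' u w) (at x)
     + jacobian (\<lambda>u'. fw pb md x u' w) (at u) ** Kfb ds x"

definition rccm ::
  "('n::finite, 'm::finite, 'l::finite, 'c::finite) plant \<Rightarrow> ('n, 'm, 'l) model \<Rightarrow> ('n, 'm) design \<Rightarrow> bool"
where
  "rccm pb md ds \<longleftrightarrow>
     cont_diff (Mmet ds) \<and> (\<forall>x. pd (Mmet ds x)) \<and> continuous_on UNIV (Kfb ds) \<and>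
     0 < rho ds \<and> rho ds < 1 \<and> 0 < alpha1 ds \<and> 0 < alpha2 ds \<and>
     (\<forall>x u w. (x, u) \<in> Zset pb \<and> w \<in> Dset \<longrightarrow>
        (let xp = fw pb md x u w; A = Acl pb md ds x u w in
          loewner_le (transpose A ** Mmet ds xp ** A) ((1 - rho ds) *\<^sub>R Mmet ds x) \<and>
          loewner_le (mat (alpha1 ds)) (Mmet ds x) \<and> loewner_le (Mmet ds x) (mat (alpha2 ds)) \<and>
          loewner_le (Mmet ds xp) (mat (alpha2 ds))))"

(* \<open>C1_differentiable_on\<close> asks for two-sided derivatives at 0 and 1; every C^1 curve on [0,1]
   extends to such a curve, and only its values on [0,1] matter. *)
definition Curves :: "real^'n \<Rightarrow> real^'n \<Rightarrow> (real \<Rightarrow> real^'n) set" where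
  "Curves xb x = {\<gamma>. \<gamma> C1_differentiable_on {0..1} \<and> \<gamma> 0 = xb \<and> \<gamma> 1 = x}"

definition curve_length :: "(real^'n \<Rightarrow> real^'n^'n) \<Rightarrow> (real \<Rightarrow> real^'n) \<Rightarrow> real" where
  "curve_length M \<gamma> = integral {0..1} (\<lambda>s. wnorm (M (\<gamma> s)) (vector_derivative \<gamma> (at s)))"

definition Vdist :: "(real^'n \<Rightarrow> real^'n^'n) \<Rightarrow> real^'n \<Rightarrow> real^'n \<Rightarrow> real" where
  "Vdist M x xb = (INF \<gamma>\<in>Curves xb x. curve_length M \<gamma>)"

definition geodesic :: "(real^'n \<Rightarrow> real^'n^'n) \<Rightarrow> real^'n \<Rightarrow> real^'n \<Rightarrow> (real \<Rightarrow> real^'n) \<Rightarrow> bool" where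
  "geodesic M xb x \<gamma> \<longleftrightarrow> \<gamma> \<in> Curves xb x \<and> (\<forall>\<gamma>'\<in>Curves xb x. curve_length M \<gamma> \<le> curve_length M \<gamma>')"

definition gamma_u ::
  "('n::finite, 'm::finite) design \<Rightarrow> real^'n \<Rightarrow> real^'n \<Rightarrow> real^'m \<Rightarrow> real \<Rightarrow> real^'m" where
  "gamma_u ds x xb ub s = ub +
     integral {0..s} (\<lambda>t. Kfb ds (geo ds xb x t) *v vector_derivative (geo ds xb x) (at t))"

definition kappa ::
  "('n::finite, 'm::finite) design \<Rightarrow> real^'n \<Rightarrow> real^'n \<Rightarrow> real^'m \<Rightarrow> real^'m" where
  "kappa ds x xb ub = gamma_u ds x xb ub 1"

definition hrow ::
  "('n::finite, 'm::finite, 'l::finite, 'c::finite) plant \<Rightarrow> ('n, 'm) design \<Rightarrow> 'c \<Rightarrow>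
   real^'n \<Rightarrow> real^'m \<Rightarrow> real^'n" where
  "hrow pb ds j x u = grad (\<lambda>x'. hcon pb j (x', u)) x + grad (\<lambda>u'. hcon pb j (x, u')) u v* Kfb ds x"

definition ctight ::
  "('n::{finite,linorder}, 'm::finite, 'l::finite, 'c::finite) plant \<Rightarrow> ('n, 'm) design \<Rightarrow> 'c \<Rightarrow> real"
where
  "ctight pb ds j =
     (SUP (x, u)\<in>Zset pb. norm (hrow pb ds j x u v* matrix_inv (chol (Mmet ds x))))"

(* If c_j = 0, the rows defining c_j vanish on Z; they are required to vanish also near Z. Otherwise
   h_j may be positive off Z along curves (gamma, gamma^u) starting in Z with h_j = 0, and the
   tightened constraints (with zero tightening) do not keep such curves in Z. *)
definition zero_tightening_ok ::
  "('n::{finite,linorder}, 'm::finite, 'l::finite, 'c::finite) plant \<Rightarrow> ('n, 'm) design \<Rightarrow> bool" where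
  "zero_tightening_ok pb ds \<longleftrightarrow> (\<forall>j. ctight pb ds j = 0 \<longrightarrow>
     (\<exists>W. open W \<and> Zset pb \<subseteq> W \<and> (\<forall>(x, u)\<in>W. hrow pb ds j x u = 0)))"


section \<open>Tube MPC problem\<close>

definition stage_cost ::
  "('n::finite, 'm::finite) design \<Rightarrow> real^'n \<Rightarrow> real^'m \<Rightarrow> real \<Rightarrow> real" where
  "stage_cost ds xb ub \<delta> = (wnorm (Qmat ds) xb)\<^sup>2 + (wnorm (Rmat ds) ub)\<^sup>2 + lam ds * \<delta>\<^sup>2"

definition delta_next ::
  "('n::finite, 'm::finite, 'l::finite, 'c::finite) plant \<Rightarrow> ('n, 'm, 'l) model \<Rightarrow> ('n, 'm) design \<Rightarrow>
   real^'n \<Rightarrow> real^'m \<Rightarrow> real \<Rightarrow> real" where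
  "delta_next pb md ds xb ub \<delta> = sqrt (1 - rho ds) * \<delta>
     + sqrt (alpha2 ds) * (cx md * norm (Phihat pb xb) + cu md * norm ub)"

definition terminal_ok ::
  "('n::{finite,linorder}, 'm::finite, 'l::finite, 'c::finite) plant \<Rightarrow> ('n, 'm, 'l) model \<Rightarrow>
   ('n, 'm) design \<Rightarrow> bool" where
  "terminal_ok pb md ds \<longleftrightarrow>
     Xf ds \<subseteq> UNIV \<times> {0..} \<and> (\<forall>xb. \<forall>\<delta>\<ge>0. 0 \<le> lf ds xb \<delta>) \<and>
     (\<forall>(xb, \<delta>)\<in>Xf ds.
        let xp = Fhat pb md xb (kf ds xb); \<delta>p = delta_next pb md ds xb (kf ds xb) \<delta> in
          (xp, \<delta>p) \<in> Xf ds \<and>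
          (\<forall>j. hcon pb j (xb, kf ds xb) + ctight pb ds j * \<delta> \<le> 0 \<and>
               hcon pb j (xp, kf ds xp) + ctight pb ds j * \<delta>p \<le> 0) \<and>
          stage_cost ds xb (kf ds xb) \<delta> \<le> lf ds xb \<delta> - lf ds xp \<delta>p \<and>
          (\<forall>\<delta>'\<in>{0..\<delta>}. (xb, \<delta>') \<in> Xf ds \<and> lf ds xb \<delta>' \<le> lf ds xb \<delta>))"

definition design_ok :: "('n::finite, 'm::finite) design \<Rightarrow> bool" where
  "design_ok ds \<longleftrightarrow> pd (Qmat ds) \<and> pd (Rmat ds) \<and> 0 < lam ds \<and> 1 \<le> hor ds \<and>
     (\<forall>xb x. geodesic (Mmet ds) xb x (geo ds xb x))"

(* Only the entries with index \<le> N (inputs: < N) of the three sequences are relevant. *)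
record ('n, 'm) plan =
  xbar :: "nat \<Rightarrow> real^('n::finite)"
  ubar :: "nat \<Rightarrow> real^('m::finite)"
  dlt  :: "nat \<Rightarrow> real"

definition cost :: "('n::finite, 'm::finite) design \<Rightarrow> ('n, 'm) plan \<Rightarrow> real" where
  "cost ds p = (\<Sum>i<hor ds. stage_cost ds (xbar p i) (ubar p i) (dlt p i))
     + lf ds (xbar p (hor ds)) (dlt p (hor ds))"

definition feasible ::
  "('n::{finite,linorder}, 'm::finite, 'l::finite, 'c::finite) plant \<Rightarrow> ('n, 'm, 'l) model \<Rightarrow>
   ('n, 'm) design \<Rightarrow> (real, 'n) vec \<Rightarrow> ('n, 'm) plan \<Rightarrow> bool" where
  "feasible pb md ds x p \<longleftrightarrow>
     (\<forall>i<hor ds.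
        xbar p (Suc i) = Fhat pb md (xbar p i) (ubar p i) \<and>
        dlt p (Suc i) = delta_next pb md ds (xbar p i) (ubar p i) (dlt p i) \<and>
        (\<forall>j. hcon pb j (xbar p i, ubar p i) + ctight pb ds j * dlt p i \<le> 0)) \<and>
     Vdist (Mmet ds) x (xbar p 0) = dlt p 0 \<and>
     (xbar p (hor ds), dlt p (hor ds)) \<in> Xf ds"

definition XN ::
  "('n::{finite,linorder}, 'm::finite, 'l::finite, 'c::finite) plant \<Rightarrow> ('n, 'm, 'l) model \<Rightarrow>
   ('n, 'm) design \<Rightarrow> ((real, 'n) vec) set" where
  "XN pb md ds = {x. \<exists>p. feasible pb md ds x p}"


section \<open>Online algorithm and closed loop\<close>

primrec roll_x ::
  "('n::finite, 'm::finite, 'l::finite, 'c::finite) plant \<Rightarrow> ('n, 'm, 'l) model \<Rightarrow>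
   (nat \<Rightarrow> real^'m) \<Rightarrow> real^'n \<Rightarrow> nat \<Rightarrow> real^'n" where
  "roll_x pb md us x0 0 = x0"
| "roll_x pb md us x0 (Suc i) = Fhat pb md (roll_x pb md us x0 i) (us i)"

primrec roll_delta ::
  "('n::finite, 'm::finite, 'l::finite, 'c::finite) plant \<Rightarrow> ('n, 'm, 'l) model \<Rightarrow> ('n, 'm) design \<Rightarrow>
   (nat \<Rightarrow> real^'m) \<Rightarrow> real^'n \<Rightarrow> real \<Rightarrow> nat \<Rightarrow> real" where
  "roll_delta pb md ds us x0 \<delta>0 0 = \<delta>0"
| "roll_delta pb md ds us x0 \<delta>0 (Suc i) =
     delta_next pb md ds (roll_x pb md us x0 i) (us i) (roll_delta pb md ds us x0 \<delta>0 i)"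

definition shifted ::
  "('n::finite, 'm::finite, 'l::finite, 'c::finite) plant \<Rightarrow> ('n, 'm, 'l) model \<Rightarrow> ('n, 'm) design \<Rightarrow>
   real^'n \<Rightarrow> ('n, 'm) plan \<Rightarrow> ('n, 'm) plan" where
  "shifted pb md ds x p =
     (let us = (\<lambda>i. if Suc i < hor ds then ubar p (Suc i) else kf ds (xbar p (hor ds))) in
      \<lparr>xbar = roll_x pb md us (xbar p 1), ubar = us,
       dlt = roll_delta pb md ds us (xbar p 1) (Vdist (Mmet ds) x (xbar p 1))\<rparr>)"

definition local_plan :: "('n::finite, 'm::finite) design \<Rightarrow> real^'n \<Rightarrow> ('n, 'm) plan" where
  "local_plan ds x =
     \<lparr>xbar = (\<lambda>_. 0), ubar = (\<lambda>_. 0), dlt = (\<lambda>i. sqrt (1 - rho ds) ^ i * Vdist (Mmet ds) x 0)\<rparr>"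

(* \<open>mid\<close> is the candidate after the (possibly unsuccessful) run of the numerical solver. *)
definition alg_step ::
  "('n::{finite,linorder}, 'm::finite, 'l::finite, 'c::finite) plant \<Rightarrow> ('n, 'm, 'l) model \<Rightarrow>
   ('n, 'm) design \<Rightarrow> (real, 'n) vec \<Rightarrow> ('n, 'm) plan \<Rightarrow> ('n, 'm) plan \<Rightarrow> bool" where
  "alg_step pb md ds x init ret \<longleftrightarrow>
     (\<exists>mid. (mid = init \<or> (feasible pb md ds x mid \<and> cost ds mid < cost ds init)) \<and>
        ret = (if feasible pb md ds x (local_plan ds x) \<and> cost ds (local_plan ds x) < cost ds mid
               then local_plan ds x else mid))"

definition closed_loop ::
  "('n::{finite,linorder}, 'm::finite, 'l::finite, 'c::finite) plant \<Rightarrow> ('n, 'm, 'l) model \<Rightarrow>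
   ('n, 'm) design \<Rightarrow> (nat \<Rightarrow> (real, 'n) vec) \<Rightarrow> (nat \<Rightarrow> (real, 'm) vec) \<Rightarrow> (nat \<Rightarrow> ('n, 'm) plan) \<Rightarrow> bool" where
  "closed_loop pb md ds xs us ret \<longleftrightarrow>
     (\<exists>init. feasible pb md ds (xs 0) init \<and> alg_step pb md ds (xs 0) init (ret 0)) \<and>
     (\<forall>k. alg_step pb md ds (xs (Suc k)) (shifted pb md ds (xs (Suc k)) (ret k)) (ret (Suc k))) \<and>
     (\<forall>k. us k = kappa ds (xs k) (xbar (ret k) 0) (ubar (ret k) 0) \<and>
          xs (Suc k) = Fmap pb (xs k) (us k))"

definition exponentially_stable ::
  "('n::{finite,linorder}, 'm::finite, 'l::finite, 'c::finite) plant \<Rightarrow> ('n, 'm, 'l) model \<Rightarrow>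
   ('n, 'm) design \<Rightarrow> bool" where
  "exponentially_stable pb md ds \<longleftrightarrow>
     (\<exists>C \<sigma>. 0 < C \<and> 0 < \<sigma> \<and> \<sigma> < 1 \<and>
        (\<forall>xs us ret. closed_loop pb md ds xs us ret \<and> xs 0 \<in> XN pb md ds \<longrightarrow>
           (\<forall>k. norm (xs k) \<le> C * \<sigma> ^ k * norm (xs 0))))"

definition point_terminal ::
  "('n::{finite,linorder}, 'm::finite, 'l::finite, 'c::finite) plant \<Rightarrow> ('n, 'm) design \<Rightarrow> bool" where
  "point_terminal pb ds \<longleftrightarrow>
     kf ds = (\<lambda>_. 0) \<and> (\<forall>xb. \<forall>\<delta>\<ge>0. lf ds xb \<delta> = lam ds / rho ds * \<delta>\<^sup>2) \<and>
     Xf ds = {(xb, \<delta>). 0 \<le> \<delta> \<and> xb = 0 \<and> (\<forall>j. hcon pb j (xb, kf ds xb) + ctight pb ds j * \<delta> \<le> 0)}"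

end

theory Submission
  imports Defs
begin

text \<open>On the event where the error certificate holds, the true successor of a state is the image under
  \<open>f\<^sub>w\<close> of one admissible disturbance \<open>w\<close>. A tightened constraint at the nominal point keeps the whole
  geodesic, lifted by the feedback, inside the constraint set, where the contraction condition applies
  pointwise; hence the Riemannian distance between true and nominal state satisfies the recursion that
  defines the tube size. Monotonicity in the tube size then makes the shifted plan feasible with a cost
  that decreases by the first stage cost. This stage cost dominates \<open>\<parallel>x\<parallel>\<^sup>2\<close>, which gives convergence. For
  the point terminal set the cost is moreover at most a multiple of \<open>\<parallel>x\<parallel>\<^sup>2\<close>, so it decays geometrically.\<close>


section \<open>Cholesky factors and weighted norms\<close>

text \<open>The metric bounds and the contraction inequality hold only over \<open>Zset pb\<close>,
  and a geodesic may leave that set. Membership of the whole lifted curve therefore has to be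
  settled before any estimate along it. The tightening constants are built for this: c_j bounds the
  growth of h_j per unit of Riemannian length. They are stated through \<open>chol\<close>, a choice
  operator, so existence of the factor comes first.

  The infimum \<open>Vdist\<close> ranges over C^1 curves with two-sided derivatives, whereas the
  estimate for the successor produces two pieces that meet in a corner and have one-sided
  derivatives at their ends. This is the reason for the reparametrization by
  \<open>smoothstep\<close>.

  The algorithm returns no optimal plan, so no value function is at hand. The returned cost is known
  to be at most that of the initial candidate and, whenever the local plan is feasible, at most that
  of the local plan. The first fact yields the decrease along the closed loop, the second the
  quadratic upper bound near the origin on which exponential decay rests.\<close>

text \<open>The factorization eliminates the least index of \<open>S\<close>; the induction hypothesis applies to the
  Schur complement.\<close>

lemma cholesky_on:
  fixes S :: "'n::{finite,linorder} set" and P :: "((real, 'n) vec, 'n) vec"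
  assumes "finite S"
    and "transpose P = P"
    and "\<And>i j. i \<notin> S \<Longrightarrow> P $ i $ j = 0"
    and "\<And>v. \<lbrakk>v \<noteq> 0; \<And>i. i \<notin> S \<Longrightarrow> v $ i = 0\<rbrakk> \<Longrightarrow> 0 < v \<bullet> (P *v v)"
  shows "\<exists>L. (\<forall>i j. j < i \<or> i \<notin> S \<or> j \<notin> S \<longrightarrow> L $ i $ j = 0) \<and> (\<forall>i\<in>S. 0 < L $ i $ i) \<and> P = transpose L ** L"
  using assms
proof (induction S arbitrary: P rule: finite_linorder_min_induct)
  case empty
  have "P = transpose 0 ** 0" using empty.prems(2) by (simp add: vec_eq_iff matrix_matrix_mult_def)
  then show ?case by (intro exI[of _ 0]) simp
next
  case (insert k S)
  have sym: "P $ i $ j = P $ j $ i" for i j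
    using insert.prems(1) by (metis transpose_def vec_lambda_beta)
  have Pz: "P $ i $ j = 0" if "i \<notin> insert k S \<or> j \<notin> insert k S" for i j
    using that insert.prems(2) sym by metis
  have kS: "k \<notin> S" using insert.hyps by auto
  define p where "p = P $ k"
  define d where "d = P $ k $ k"
  have Pax: "P *v axis k 1 = p"
    by (simp add: vec_eq_iff matrix_vector_mult_def axis_def p_def sym[of _ k] if_distrib cong: if_cong)
  have axP: "axis k 1 \<bullet> (P *v v) = p \<bullet> v" for v
    by (simp add: inner_axis' p_def matrix_vector_mul_component)
  have d: "d > 0"
    using insert.prems(3)[of "axis k 1"] by (auto simp: Pax d_def p_def inner_axis' axis_eq_0_iff) (auto simp: axis_def)
  define P' where "P' = (\<chi> i j. P $ i $ j - p $ i * p $ j / d)"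
  have P'v: "P' *v v = P *v v - ((p \<bullet> v) / d) *\<^sub>R p" for v
    by (simp add: P'_def vec_eq_iff matrix_vector_mult_def inner_vec_def algebra_simps sum_subtractf
        sum_distrib_left sum_divide_distrib)
  have "\<exists>L. (\<forall>i j. j < i \<or> i \<notin> S \<or> j \<notin> S \<longrightarrow> L $ i $ j = 0) \<and> (\<forall>i\<in>S. 0 < L $ i $ i) \<and> P' = transpose L ** L"
  proof (rule insert.IH)
    show "transpose P' = P'"
      by (simp add: vec_eq_iff transpose_def P'_def sym mult.commute)
    show "P' $ i $ j = 0" if "i \<notin> S" for i j
      using that Pz[of i j] d sym[of i k] Pz[of k i] by (cases "i = k") (auto simp: P'_def p_def d_def)
    fix v :: "(real, 'n) vec"
    assume v: "v \<noteq> 0" "\<And>i. i \<notin> S \<Longrightarrow> v $ i = 0"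
    \<comment> \<open>The multiple of the \<open>k\<close>-th axis is chosen so that
      \<open>p \<bullet> w = 0\<close>; the form of \<open>P\<close> at \<open>w\<close> then equals
      the form of the Schur complement at \<open>v\<close>.\<close>
    define w where "w = v - ((p \<bullet> v) / d) *\<^sub>R axis k 1"
    obtain i where i: "v $ i \<noteq> 0" using v(1) by (auto simp: vec_eq_iff)
    have "i \<noteq> k" using i v(2) kS by auto
    then have "w $ i \<noteq> 0" using i by (simp add: w_def axis_def)
    then have "w \<noteq> 0" by (metis zero_index)
    moreover have "w $ i = 0" if "i \<notin> insert k S" for i
      using that v(2)[of i] by (auto simp: w_def axis_def)
    ultimately have "0 < w \<bullet> (P *v w)" by (rule insert.prems(3))
    also have "P *v w = P *v v - ((p \<bullet> v) / d) *\<^sub>R p"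
      by (simp add: w_def matrix_vector_mult_diff_distrib matrix_vector_mult_scaleR Pax)
    also have "w \<bullet> \<dots> = v \<bullet> (P *v v) - (p \<bullet> v) * (p \<bullet> v) / d"
      using d by (simp add: w_def inner_diff_left inner_diff_right axP)
        (simp add: inner_axis' p_def d_def matrix_vector_mul_component inner_commute)
    also have "\<dots> = v \<bullet> (P' *v v)"
      by (simp add: P'v inner_diff_right inner_commute)
    finally show "0 < v \<bullet> (P' *v v)" .
  qed
  then obtain L where L: "\<And>i j. j < i \<or> i \<notin> S \<or> j \<notin> S \<Longrightarrow> L $ i $ j = 0" "\<And>i. i \<in> S \<Longrightarrow> 0 < L $ i $ i"
    "P' = transpose L ** L" by metis
  \<comment> \<open>Row \<open>k\<close> and column \<open>k\<close> of \<open>L\<close> vanish, so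
    filling row \<open>k\<close> with \<open>p / sqrt d\<close> adds exactly the rank-one term
    removed in \<open>P'\<close>. As \<open>k\<close> is the least index, the result stays upper
    triangular.\<close>
  define L2 where "L2 = (\<chi> i j. if i = k then p $ j / sqrt d else L $ i $ j)"
  have "P $ i $ j = (transpose L2 ** L2) $ i $ j" for i j
  proof -
    have "(transpose L2 ** L2) $ i $ j = (\<Sum>l\<in>UNIV. L2 $ l $ i * L2 $ l $ j)"
      by (simp add: matrix_matrix_mult_def transpose_def)
    also have "\<dots> = L2 $ k $ i * L2 $ k $ j + (\<Sum>l\<in>UNIV - {k}. L2 $ l $ i * L2 $ l $ j)"
      by (rule sum.remove) auto
    also have "(\<Sum>l\<in>UNIV - {k}. L2 $ l $ i * L2 $ l $ j) = (\<Sum>l\<in>UNIV - {k}. L $ l $ i * L $ l $ j)"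
      by (rule sum.cong) (auto simp: L2_def)
    also have "\<dots> = (\<Sum>l\<in>UNIV. L $ l $ i * L $ l $ j)"
      using L(1)[of _ k] kS by (intro sum.mono_neutral_left) auto
    also have "\<dots> = P' $ i $ j"
      by (simp add: L(3) matrix_matrix_mult_def transpose_def)
    finally show ?thesis using d by (simp add: P'_def L2_def)
  qed
  then have "P = transpose L2 ** L2" by (simp add: vec_eq_iff)
  moreover have "L2 $ i $ j = 0" if "j < i \<or> i \<notin> insert k S \<or> j \<notin> insert k S" for i j
  proof (cases "i = k")
    case True
    then have "j \<notin> insert k S" using that insert.hyps by force
    then show ?thesis using True Pz by (simp add: L2_def p_def)
  next
    case False
    then show ?thesis using that L(1)[of j i] kS by (auto simp: L2_def)
  qed
  moreover have "0 < L2 $ i $ i" if "i \<in> insert k S" for i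
    using that L(2) kS d by (auto simp: L2_def d_def p_def)
  ultimately show ?case by metis
qed

lemma inner_transpose_mult: "x \<bullet> (transpose A *v y) = (A *v x) \<bullet> (y :: real^'n)"
  by (metis dot_lmul_matrix vector_transpose_matrix)

lemma
  fixes A :: "real^'n^'n"
  assumes "invertible A"
  shows matrix_inv_left: "matrix_inv A ** A = mat 1"
    and matrix_inv_right: "A ** matrix_inv A = mat 1"
  using someI_ex[OF assms[unfolded invertible_def]] by (auto simp: matrix_inv_def)

text \<open>Existence turns the specification of the choice \<open>chol\<close> into usable facts. A
  kernel vector of \<open>chol P\<close> would have zero energy under \<open>P\<close>, hence the
  factor is invertible.\<close>

lemma
  fixes P :: "((real, 'n::{finite,linorder}) vec, 'n) vec"
  assumes "pd P"
  shows invertible_chol: "invertible (chol P)"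
    and wnorm_eq_norm_chol: "wnorm P v = norm (chol P *v v)"
proof -
  have "\<exists>L. (\<forall>i j. j < i \<longrightarrow> L $ i $ j = 0) \<and> (\<forall>i. 0 < L $ i $ i) \<and> P = transpose L ** L"
    using cholesky_on[of UNIV P] assms by (force simp: pd_def)
  from someI_ex[OF this] have *: "transpose (chol P) ** chol P = P"
    by (simp add: chol_def)
  have **: "v \<bullet> (P *v v) = (chol P *v v) \<bullet> (chol P *v v)" for v
    by (metis * matrix_vector_mul_assoc inner_transpose_mult)
  then show "wnorm P v = norm (chol P *v v)"
    by (simp add: wnorm_def norm_eq_sqrt_inner)
  have "v = 0" if "chol P *v v = 0" for v
    using **[of v] that assms by (force simp: pd_def)
  then show "invertible (chol P)"
    using matrix_left_invertible_ker invertible_left_inverse by blast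
qed

text \<open>Cauchy-Schwarz after inserting the factor and its inverse. The first factor on the right
  is the dual norm of \<open>wnorm P\<close>, which explains the form of the tightening
  constants.\<close>

lemma inner_le_wnorm:
  fixes P :: "((real, 'n::{finite,linorder}) vec, 'n) vec"
  assumes "pd P"
  shows "a \<bullet> v \<le> norm (a v* matrix_inv (chol P)) * wnorm P v"
proof -
  have "a \<bullet> v = a \<bullet> (matrix_inv (chol P) *v (chol P *v v))"
    by (simp add: matrix_vector_mul_assoc matrix_inv_left invertible_chol assms)
  also have "\<dots> = (a v* matrix_inv (chol P)) \<bullet> (chol P *v v)"
    by (simp add: dot_lmul_matrix)
  also have "\<dots> \<le> norm (a v* matrix_inv (chol P)) * norm (chol P *v v)"
    by (rule norm_cauchy_schwarz)
  finally show ?thesis by (simp add: wnorm_eq_norm_chol assms)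
qed

lemma loewner_le_inner: "loewner_le P Q \<Longrightarrow> v \<bullet> (P *v v) \<le> v \<bullet> (Q *v v)"
  by (simp add: loewner_le_def psd_def matrix_vector_mult_diff_rdistrib inner_diff_right)

lemma wnorm_mono: "loewner_le P Q \<Longrightarrow> wnorm P v \<le> wnorm Q v"
  by (simp add: wnorm_def loewner_le_inner)

lemma wnorm_nonneg: "pd P \<Longrightarrow> 0 \<le> wnorm P v"
  by (cases "v = 0") (auto simp: wnorm_def pd_def less_imp_le)

lemma wnorm_eq_0_iff: "pd P \<Longrightarrow> wnorm P v = 0 \<longleftrightarrow> v = 0"
  by (auto simp: wnorm_def pd_def)

lemma wnorm_zero [simp]: "wnorm P 0 = 0"
  by (simp add: wnorm_def)

lemma wnorm_mat: "wnorm (mat a) v = sqrt a * norm v"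
proof -
  have "mat a *v v = a *\<^sub>R v"
    by (simp add: vec_eq_iff matrix_vector_mult_def mat_def if_distrib[where f="\<lambda>x. x * _"] cong: if_cong)
  then show ?thesis by (simp add: wnorm_def real_sqrt_mult norm_eq_sqrt_inner)
qed

lemma wnorm_scaleR_vector: "wnorm P (c *\<^sub>R v) = \<bar>c\<bar> * wnorm P v"
proof -
  have "c *\<^sub>R v \<bullet> (P *v (c *\<^sub>R v)) = c\<^sup>2 * (v \<bullet> (P *v v))"
    by (simp add: matrix_vector_mult_scaleR power2_eq_square)
  then show ?thesis by (simp add: wnorm_def real_sqrt_mult)
qed

lemma wnorm_scaleR_matrix: "wnorm (c *\<^sub>R P) v = sqrt c * wnorm P v"
  by (simp add: wnorm_def real_sqrt_mult flip: scaleR_matrix_vector_assoc)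

lemma wnorm_congruence: "wnorm (transpose A ** P ** A) v = wnorm P (A *v v)"
  by (simp add: wnorm_def inner_transpose_mult del: transpose_matrix_vector flip: matrix_vector_mul_assoc)

lemma continuous_on_wnorm:
  assumes "continuous_on S P" "continuous_on S y"
  shows "continuous_on S (\<lambda>s. wnorm (P s) (y s))"
  unfolding wnorm_def inner_vec_def matrix_vector_mult_def
  by (intro continuous_intros continuous_on_component assms)

text \<open>Makes the suprema \<open>ctight\<close> finite without continuity of the Cholesky factor
  in the state.\<close>

lemma norm_row_chol_le:
  fixes P :: "((real, 'n::{finite,linorder}) vec, 'n) vec"
  assumes P: "pd P" and a: "0 < \<alpha>" "loewner_le (mat \<alpha>) P"
  shows "norm (r v* matrix_inv (chol P)) \<le> norm r / sqrt \<alpha>"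
proof -
  define q where "q = r v* matrix_inv (chol P)"
  define y where "y = matrix_inv (chol P) *v q"
  have q: "q = chol P *v y"
    by (simp add: y_def matrix_vector_mul_assoc matrix_inv_right invertible_chol P)
  have "sqrt \<alpha> * norm y \<le> norm q"
    using wnorm_mono[OF a(2), of y] by (simp add: wnorm_mat wnorm_eq_norm_chol P q)
  then have y: "norm y \<le> norm q / sqrt \<alpha>" using a by (simp add: field_simps)
  have "norm q * norm q = q \<bullet> q" by (simp add: dot_square_norm power2_eq_square)
  also have "\<dots> = r \<bullet> y" by (subst (1) q_def) (simp add: y_def dot_lmul_matrix)
  also have "\<dots> \<le> norm r * norm y" by (rule norm_cauchy_schwarz)
  also have "\<dots> \<le> norm r * (norm q / sqrt \<alpha>)" by (rule mult_left_mono[OF y]) simp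
  finally have "norm q * norm q \<le> norm q * (norm r / sqrt \<alpha>)" by (simp add: ac_simps)
  moreover have "0 \<le> norm r / sqrt \<alpha>" using a by simp
  ultimately have "norm q \<le> norm r / sqrt \<alpha>"
    by (cases "q = 0") (simp, meson mult_left_le_imp_le zero_less_norm_iff)
  then show ?thesis by (simp add: q_def)
qed


section \<open>Curves and Riemannian distance\<close>

lemma has_real_derivative_max_sq:
  "((\<lambda>t. (max 0 t)\<^sup>2) has_real_derivative 2 * max 0 t) (at (t::real))"
proof (cases t "0 :: real" rule: linorder_cases)
  case less
  have "((\<lambda>t. 0) has_real_derivative 2 * max 0 t) (at t)" using less by (simp add: max_def)
  then show ?thesis
    by (rule has_field_derivative_transform_within_open[of _ _ _ "{..<0}"]) (use less in auto)
next
  case greater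
  have "((\<lambda>t. t\<^sup>2) has_real_derivative 2 * max 0 t) (at t)"
    using greater by (auto intro!: derivative_eq_intros)
  then show ?thesis
    by (rule has_field_derivative_transform_within_open[of _ _ _ "{0<..}"]) (use greater in auto)
next
  case equal
  have "((\<lambda>h::real. (max 0 h)\<^sup>2 / h) \<longlongrightarrow> 0) (at 0)"
    by (rule Lim_null_comparison[where g = "\<lambda>h. \<bar>h\<bar>"])
      (auto intro!: always_eventually tendsto_eq_intros simp: max_def power2_eq_square)
  then show ?thesis by (simp add: equal DERIV_def)
qed

text \<open>The primitive of the hat function on \<open>[0, 1]\<close>, written with squared positive parts to avoid case
  distinctions.\<close>

definition smoothstep :: "real \<Rightarrow> real" where
  "smoothstep t = 2 * (max 0 t)\<^sup>2 - 4 * (max 0 (t - 1/2))\<^sup>2 + 2 * (max 0 (t - 1))\<^sup>2"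

definition smoothstep' :: "real \<Rightarrow> real" where
  "smoothstep' t = 4 * max 0 t - 8 * max 0 (t - 1/2) + 4 * max 0 (t - 1)"

lemma smoothstep_has_derivative: "(smoothstep has_real_derivative smoothstep' t) (at t)"
proof -
  have "((\<lambda>t. (max 0 (t - c))\<^sup>2) has_real_derivative 2 * max 0 (t - c)) (at t)" for c :: real
  proof -
    have "((\<lambda>t. t - c) has_real_derivative 1) (at t)" by (auto intro!: derivative_eq_intros)
    from DERIV_chain2[where f = "\<lambda>t. (max 0 t)\<^sup>2" and g = "\<lambda>t. t - c", OF has_real_derivative_max_sq this]
    show ?thesis by simp
  qed
  note D = DERIV_cmult[OF this]
  have "(smoothstep has_real_derivative
      2 * (2 * max 0 (t - 0)) - 4 * (2 * max 0 (t - 1/2)) + 2 * (2 * max 0 (t - 1))) (at t)"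
    unfolding smoothstep_def[abs_def] using D[of 2 0] D[of 4 "1/2"] D[of 2 1]
    by (simp only: diff_zero) (intro DERIV_add DERIV_diff)
  then show ?thesis by (simp add: smoothstep'_def)
qed

lemma smoothstep_outside:
  "t \<le> 0 \<Longrightarrow> smoothstep t = 0" "t \<le> 0 \<Longrightarrow> smoothstep' t = 0"
  "1 \<le> t \<Longrightarrow> smoothstep t = 1" "1 \<le> t \<Longrightarrow> smoothstep' t = 0"
  by (auto simp: smoothstep_def smoothstep'_def power2_eq_square algebra_simps)

lemma smoothstep'_nonneg: "0 \<le> smoothstep' t"
  by (auto simp: smoothstep'_def max_def)

lemma smoothstep_in: "smoothstep t \<in> {0..1}"
proof -
  have mono: "smoothstep s \<le> smoothstep t" if "s \<le> t" for s t
    using that by (rule DERIV_nonneg_imp_nondecreasing) (use smoothstep_has_derivative smoothstep'_nonneg in blast)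
  show ?thesis using mono[of "min t 0" t] mono[of t "max t 1"] by (simp add: smoothstep_outside)
qed

lemma continuous_on_smoothstep' [continuous_intros]:
  "continuous_on S g \<Longrightarrow> continuous_on S (\<lambda>s. smoothstep' (g s))"
  unfolding smoothstep'_def by (intro continuous_intros)

lemma continuous_on_smoothstep [continuous_intros]:
  "continuous_on S g \<Longrightarrow> continuous_on S (\<lambda>s. smoothstep (g s))"
  unfolding smoothstep_def by (intro continuous_intros)

text \<open>Only one-sided derivatives at 0 and 1: the input curve \<open>gamma_u\<close> is not differentiable there from outside.\<close>

definition c1_curve :: "(real \<Rightarrow> 'a::real_normed_vector) \<Rightarrow> (real \<Rightarrow> 'a) \<Rightarrow> bool" where
  "c1_curve \<gamma> \<gamma>' \<longleftrightarrow> continuous_on {0..1} \<gamma>' \<and>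
     (\<forall>s\<in>{0..1}. (\<gamma> has_vector_derivative \<gamma>' s) (at s within {0..1}))"

lemma c1_curve_continuous: "c1_curve \<gamma> \<gamma>' \<Longrightarrow> continuous_on {0..1} \<gamma>"
  unfolding c1_curve_def by (meson continuous_on_vector_derivative)

text \<open>The inner map takes all of the real line into \<open>{0..1}\<close>, so one-sided
  derivatives of \<open>\<gamma>\<close> at the ends already give a two-sided derivative of the
  composition.\<close>

lemma c1_curve_smoothstep:
  assumes "c1_curve \<gamma> \<gamma>'"
  shows "((\<lambda>s. \<gamma> (smoothstep (2 * s - a))) has_vector_derivative
    (2 * smoothstep' (2 * s - a)) *\<^sub>R \<gamma>' (smoothstep (2 * s - a))) (at s)"
proof -
  have "((\<lambda>s. smoothstep (2 * s - a)) has_real_derivative smoothstep' (2 * s - a) * 2) (at s)"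
    by (rule DERIV_chain2[OF smoothstep_has_derivative]) (auto intro!: derivative_eq_intros)
  then have 1: "((\<lambda>s. smoothstep (2 * s - a)) has_vector_derivative 2 * smoothstep' (2 * s - a)) (at s)"
    by (simp add: has_real_derivative_iff_has_vector_derivative mult.commute)
  have "(\<gamma> has_vector_derivative \<gamma>' (smoothstep (2 * s - a)))
      (at (smoothstep (2 * s - a)) within range (\<lambda>s. smoothstep (2 * s - a)))"
    using assms smoothstep_in unfolding c1_curve_def
    by (meson has_vector_derivative_within_subset image_subsetI)
  from vector_diff_chain_within[OF 1 this] show ?thesis by (simp add: o_def)
qed

text \<open>Invariance of length: \<open>a = 0\<close> selects the first half of the unit interval
  and \<open>a = 1\<close> the second, and on either half \<open>2 * s - a\<close> runs once through
  \<open>{0..1}\<close>.\<close>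

lemma smoothstep_substitution:
  assumes f: "continuous_on {0..1} (f :: real \<Rightarrow> real)" and a: "a \<in> {0, 1}"
  shows "((\<lambda>s. 2 * smoothstep' (2 * s - a) * f (smoothstep (2 * s - a))) has_integral integral {0..1} f)
    {a / 2..(a + 1) / 2}"
proof -
  have "((\<lambda>s. (smoothstep' (2 * s - a) * 2) *\<^sub>R f (smoothstep (2 * s - a))) has_integral
      integral {smoothstep (2 * (a / 2) - a)..smoothstep (2 * ((a + 1) / 2) - a)} f) {a / 2..(a + 1) / 2}"
  proof (rule has_integral_substitution[where c = 0 and d = 1])
    show "((\<lambda>s. smoothstep (2 * s - a)) has_real_derivative smoothstep' (2 * s - a) * 2)
      (at s within {a / 2..(a + 1) / 2})" for s
      by (rule has_field_derivative_at_within, rule DERIV_chain2[OF smoothstep_has_derivative])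
        (auto intro!: derivative_eq_intros)
  qed (use f smoothstep_in in \<open>auto simp: smoothstep_outside\<close>)
  moreover have "smoothstep (2 * (a / 2) - a) = 0" "smoothstep (2 * ((a + 1) / 2) - a) = 1"
    by (simp_all add: smoothstep_outside field_simps)
  ultimately show ?thesis by (simp add: mult.commute[of _ 2])
qed

section \<open>Riemannian distance as an infimum of lengths\<close>

lemma curve_length_nonneg: "(\<And>x. pd (M x)) \<Longrightarrow> 0 \<le> curve_length M \<gamma>"
  unfolding curve_length_def
  \<comment> \<open>\<open>\<gamma>\<close> is arbitrary here; for a non-integrable speed
    \<open>integral\<close> takes the value 0.\<close>
  by (cases "(\<lambda>s. wnorm (M (\<gamma> s)) (vector_derivative \<gamma> (at s))) integrable_on {0..1}")
    (auto intro!: integral_nonneg wnorm_nonneg simp: not_integrable_integral)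

lemma Vdist_nonneg:
  assumes "\<And>x. pd (M x)"
  shows "0 \<le> Vdist M x xb"
proof -
  \<comment> \<open>The segment shows that the infimum is over a nonempty set.\<close>
  have "linepath xb x \<in> Curves xb x"
    by (auto simp: Curves_def C1_differentiable_on_def linepath_0' linepath_1'
        intro!: exI[of _ "\<lambda>_. x - xb"] continuous_intros has_vector_derivative_linepath_within)
  then show ?thesis unfolding Vdist_def
    by (intro cINF_greatest) (auto intro: curve_length_nonneg assms)
qed

text \<open>Slowing both curves down to speed 0 at the joint makes their concatenation \<open>C\<^sup>1\<close> without
  changing the lengths; with both reparametrizations clamped, the concatenation is a sum.\<close>

lemma Vdist_concat_le:
  assumes M: "continuous_on UNIV M" "\<And>x. pd (M x)"
    and g: "c1_curve \<gamma>1 \<gamma>1'" "c1_curve \<gamma>2 \<gamma>2'" "\<gamma>1 1 = \<gamma>2 0"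
  shows "Vdist M (\<gamma>2 1) (\<gamma>1 0) \<le> integral {0..1} (\<lambda>s. wnorm (M (\<gamma>1 s)) (\<gamma>1' s))
    + integral {0..1} (\<lambda>s. wnorm (M (\<gamma>2 s)) (\<gamma>2' s))"
proof -
  \<comment> \<open>On the first half the second summand rests at \<open>\<gamma>2 0\<close>, on the
    second half the first rests at \<open>\<gamma>1 1 = \<gamma>2 0\<close>; subtracting this common
    point leaves the moving curve.\<close>
  define c where "c s = \<gamma>1 (smoothstep (2 * s)) + \<gamma>2 (smoothstep (2 * s - 1)) - \<gamma>2 0" for s
  define c' where "c' s = (2 * smoothstep' (2 * s)) *\<^sub>R \<gamma>1' (smoothstep (2 * s))
    + (2 * smoothstep' (2 * s - 1)) *\<^sub>R \<gamma>2' (smoothstep (2 * s - 1))" for s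
  have d: "(c has_vector_derivative c' s) (at s)" for s
    unfolding c_def c'_def
    using c1_curve_smoothstep[OF g(1), of 0 s] c1_curve_smoothstep[OF g(2), of 1 s]
    by (auto intro!: derivative_eq_intros)
  have "continuous_on {0..1} (\<lambda>s. \<gamma>1' (smoothstep (2 * s)))"
    using g(1) smoothstep_in unfolding c1_curve_def
    by (auto intro!: continuous_on_compose2[of "{0..1}" \<gamma>1'] continuous_intros)
  moreover have "continuous_on {0..1} (\<lambda>s. \<gamma>2' (smoothstep (2 * s - 1)))"
    using g(2) smoothstep_in unfolding c1_curve_def
    by (auto intro!: continuous_on_compose2[of "{0..1}" \<gamma>2'] continuous_intros)
  ultimately have "continuous_on {0..1} c'"
    unfolding c'_def[abs_def] by (intro continuous_intros)
  then have "c \<in> Curves (\<gamma>1 0) (\<gamma>2 1)"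
    using d g(3) by (auto simp: Curves_def C1_differentiable_on_def c_def smoothstep_outside)
  moreover have "bdd_below (curve_length M ` Curves (\<gamma>1 0) (\<gamma>2 1))"
    by (rule bdd_belowI2[of _ 0]) (simp add: curve_length_nonneg M)
  ultimately have "Vdist M (\<gamma>2 1) (\<gamma>1 0) \<le> curve_length M c"
    unfolding Vdist_def by (rule cINF_lower[rotated])
  also have "\<dots> = integral {0..1} (\<lambda>s. wnorm (M (c s)) (c' s))"
    unfolding curve_length_def using vector_derivative_at[OF d] by simp
  also have "\<dots> = integral {0..1} (\<lambda>s. wnorm (M (\<gamma>1 s)) (\<gamma>1' s))
    + integral {0..1} (\<lambda>s. wnorm (M (\<gamma>2 s)) (\<gamma>2' s))"
  proof (rule integral_unique, rule has_integral_combine[of _ "1/2"])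
    have 1: "continuous_on {0..1} (\<lambda>s. wnorm (M (\<gamma>1 s)) (\<gamma>1' s))"
      using g(1) c1_curve_continuous[OF g(1)] M(1)
      by (auto intro!: continuous_on_wnorm continuous_on_compose2[of UNIV M] simp: c1_curve_def)
    show "((\<lambda>s. wnorm (M (c s)) (c' s)) has_integral integral {0..1} (\<lambda>s. wnorm (M (\<gamma>1 s)) (\<gamma>1' s))) {0..1/2}"
      by (rule has_integral_eq[OF _ smoothstep_substitution[OF 1, of 0, simplified]])
        (auto simp: c_def c'_def smoothstep_outside wnorm_scaleR_vector smoothstep'_nonneg)
    have 2: "continuous_on {0..1} (\<lambda>s. wnorm (M (\<gamma>2 s)) (\<gamma>2' s))"
      using g(2) c1_curve_continuous[OF g(2)] M(1)
      by (auto intro!: continuous_on_wnorm continuous_on_compose2[of UNIV M] simp: c1_curve_def)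
    show "((\<lambda>s. wnorm (M (c s)) (c' s)) has_integral integral {0..1} (\<lambda>s. wnorm (M (\<gamma>2 s)) (\<gamma>2' s))) {1/2..1}"
      by (rule has_integral_eq[OF _ smoothstep_substitution[OF 2, of 1, simplified]])
        (auto simp: c_def c'_def smoothstep_outside wnorm_scaleR_vector smoothstep'_nonneg g(3))
  qed auto
  finally show ?thesis .
qed

lemma c1_curve_const: "c1_curve (\<lambda>_. a) (\<lambda>_. 0)"
  by (simp add: c1_curve_def)

text \<open>Appending a constant curve adds no length and passes from one-sided derivatives to a
  member of \<open>Curves\<close>.\<close>

lemma Vdist_le:
  assumes M: "continuous_on UNIV M" "\<And>x. pd (M x)" and g: "c1_curve \<gamma> \<gamma>'"
  shows "Vdist M (\<gamma> 1) (\<gamma> 0) \<le> integral {0..1} (\<lambda>s. wnorm (M (\<gamma> s)) (\<gamma>' s))"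
  using Vdist_concat_le[OF M g c1_curve_const[of "\<gamma> 1"]] by simp

lemma c1_curve_segment: "c1_curve (\<lambda>s. a + s *\<^sub>R v) (\<lambda>_. v)"
  by (auto simp: c1_curve_def intro!: derivative_eq_intros)


section \<open>Derivatives of the predictor and the constraints\<close>

lemma cont_diffI:
  assumes "\<And>p. (F has_derivative F' p) (at p)" "\<And>v. continuous_on UNIV (\<lambda>p. F' p v)"
  shows "cont_diff F"
proof -
  have "frechet_derivative F (at p) = F' p" for p
    using frechet_derivative_at[OF assms(1)] by simp
  then show ?thesis using assms by (auto simp: cont_diff_def differentiable_def)
qed

lemma cont_diff_has_derivative:
  "cont_diff F \<Longrightarrow> (F has_derivative frechet_derivative F (at p)) (at p)"
  by (simp add: cont_diff_def frechet_derivative_works)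

lemma cont_diff_continuous_deriv: "cont_diff F \<Longrightarrow> continuous_on UNIV (\<lambda>p. frechet_derivative F (at p) v)"
  by (simp add: cont_diff_def)

lemma cont_diff_continuous_on: "cont_diff F \<Longrightarrow> continuous_on S F"
  by (meson cont_diff_def continuous_at_imp_continuous_on differentiable_imp_continuous_within)

lemma cont_diff_const: "cont_diff (\<lambda>_. c)"
  by (rule cont_diffI[where F' = "\<lambda>_ _. 0"]) auto

lemma cont_diff_bounded_linear: "bounded_linear f \<Longrightarrow> cont_diff f"
  by (rule cont_diffI[where F' = "\<lambda>_. f"]) (auto intro: bounded_linear_imp_has_derivative)

lemma cont_diff_add:
  assumes "cont_diff F" "cont_diff G"
  shows "cont_diff (\<lambda>p. F p + G p)"
proof (rule cont_diffI)
  show "((\<lambda>p. F p + G p) has_derivative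
    (\<lambda>v. frechet_derivative F (at p) v + frechet_derivative G (at p) v)) (at p)" for p
    by (intro has_derivative_add cont_diff_has_derivative assms)
  show "continuous_on UNIV (\<lambda>p. frechet_derivative F (at p) v + frechet_derivative G (at p) v)" for v
    by (intro continuous_on_add cont_diff_continuous_deriv assms)
qed

lemma cont_diff_sum:
  "(\<And>i. i \<in> I \<Longrightarrow> cont_diff (F i)) \<Longrightarrow> cont_diff (\<lambda>p. \<Sum>i\<in>I. F i p)"
  by (induction I rule: infinite_finite_induct) (auto intro: cont_diff_const cont_diff_add)

lemma cont_diff_scaleR:
  fixes r :: "'a::euclidean_space \<Rightarrow> real"
  assumes "cont_diff r" "cont_diff F"
  shows "cont_diff (\<lambda>p. r p *\<^sub>R F p)"
proof (rule cont_diffI)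
  show "((\<lambda>p. r p *\<^sub>R F p) has_derivative
    (\<lambda>v. r p *\<^sub>R frechet_derivative F (at p) v + frechet_derivative r (at p) v *\<^sub>R F p)) (at p)" for p
    by (rule has_derivative_scaleR[OF assms[THEN cont_diff_has_derivative]])
  show "continuous_on UNIV
    (\<lambda>p. r p *\<^sub>R frechet_derivative F (at p) v + frechet_derivative r (at p) v *\<^sub>R F p)" for v
    using assms[THEN cont_diff_continuous_deriv, of v] assms[THEN cont_diff_continuous_on, of UNIV]
    by (intro continuous_intros)
qed

lemma cont_diff_linear_comp:
  assumes "bounded_linear L" "cont_diff F"
  shows "cont_diff (\<lambda>p. L (F p))"
proof (rule cont_diffI)
  show "((\<lambda>p. L (F p)) has_derivative (\<lambda>v. L (frechet_derivative F (at p) v))) (at p)" for p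
    by (rule bounded_linear.has_derivative[OF assms(1) cont_diff_has_derivative[OF assms(2)]])
  show "continuous_on UNIV (\<lambda>p. L (frechet_derivative F (at p) v))" for v
    by (rule bounded_linear.continuous_on[OF assms(1) cont_diff_continuous_deriv[OF assms(2)]])
qed

lemma cont_diff_comp_linear:
  assumes L: "bounded_linear L" and F: "cont_diff F"
  shows "cont_diff (\<lambda>p. F (L p))"
proof (rule cont_diffI[where F' = "\<lambda>p v. frechet_derivative F (at (L p)) (L v)"])
  show "((\<lambda>p. F (L p)) has_derivative (\<lambda>v. frechet_derivative F (at (L p)) (L v))) (at p)" for p
    using has_derivative_compose[OF bounded_linear_imp_has_derivative[OF L] cont_diff_has_derivative[OF F]] .
  show "continuous_on UNIV (\<lambda>p. frechet_derivative F (at (L p)) (L v))" for v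
    by (rule continuous_on_compose2[OF cont_diff_continuous_deriv[OF F, of "L v"]])
      (auto intro: linear_continuous_on L)
qed

lemma cont_diff_vec:
  fixes F :: "'a::euclidean_space \<Rightarrow> real^'n"
  assumes "\<And>i. cont_diff (\<lambda>p. F p $ i)"
  shows "cont_diff F"
proof -
  have "F = (\<lambda>p. \<Sum>i\<in>UNIV. (F p $ i) *\<^sub>R axis i 1)"
    by (auto simp: vec_eq_iff axis_def if_distrib cong: if_cong)
  moreover have "cont_diff (\<lambda>p. \<Sum>i\<in>UNIV. (F p $ i) *\<^sub>R axis i (1::real))"
    by (intro cont_diff_sum cont_diff_scaleR cont_diff_const assms)
  ultimately show ?thesis by simp
qed

text \<open>\<open>cont_diff\<close> provides continuity for one fixed direction at a time.
  Expanding the direction in the finite basis gives continuity when base point and direction vary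
  together.\<close>

lemma continuous_on_frechet_derivative:
  assumes F: "cont_diff F" and p: "continuous_on S p" and v: "continuous_on S v"
  shows "continuous_on S (\<lambda>s. frechet_derivative F (at (p s)) (v s))"
proof -
  have lin: "linear (frechet_derivative F (at q))" for q
    using cont_diff_has_derivative[OF F] by (rule has_derivative_linear)
  have "frechet_derivative F (at q) y = (\<Sum>b\<in>Basis. (y \<bullet> b) *\<^sub>R frechet_derivative F (at q) b)" for q y
    by (subst (1) euclidean_representation[of y, symmetric])
      (simp only: linear_sum[OF lin] linear_cmul[OF lin])
  then have "(\<lambda>s. frechet_derivative F (at (p s)) (v s))
      = (\<lambda>s. \<Sum>b\<in>Basis. (v s \<bullet> b) *\<^sub>R frechet_derivative F (at (p s)) b)" by blast
  moreover have "continuous_on S (\<lambda>s. frechet_derivative F (at (p s)) b)" for b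
    by (rule continuous_on_compose2[OF cont_diff_continuous_deriv[OF F] p]) simp
  ultimately show ?thesis by (simp only:) (intro continuous_intros v)
qed

lemma c1_curve_comp:
  assumes F: "cont_diff F" and p: "c1_curve p p'"
  shows "c1_curve (\<lambda>s. F (p s)) (\<lambda>s. frechet_derivative F (at (p s)) (p' s))"
  unfolding c1_curve_def
proof (intro conjI ballI)
  show "continuous_on {0..1} (\<lambda>s. frechet_derivative F (at (p s)) (p' s))"
    using p c1_curve_continuous[OF p] by (auto intro!: continuous_on_frechet_derivative F simp: c1_curve_def)
  fix s :: real
  assume "s \<in> {0..1}"
  then have "(p has_vector_derivative p' s) (at s within {0..1})" using p by (simp add: c1_curve_def)
  then show "((\<lambda>s. F (p s)) has_vector_derivative frechet_derivative F (at (p s)) (p' s)) (at s within {0..1})"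
    using vector_derivative_diff_chain_within[of p "p' s" s "{0..1}" F] cont_diff_has_derivative[OF F]
    by (simp add: o_def has_derivative_at_withinI)
qed

lemma c1_curve_Pair:
  "c1_curve \<gamma> \<gamma>' \<Longrightarrow> c1_curve \<eta> \<eta>' \<Longrightarrow> c1_curve (\<lambda>s. (\<gamma> s, \<eta> s)) (\<lambda>s. (\<gamma>' s, \<eta>' s))"
  by (auto simp: c1_curve_def intro!: continuous_intros has_vector_derivative_Pair)

lemma c1_curve_has_integral:
  fixes \<gamma> :: "real \<Rightarrow> 'a::banach"
  assumes "c1_curve \<gamma> \<gamma>'" "0 \<le> a" "a \<le> b" "b \<le> 1"
  shows "(\<gamma>' has_integral (\<gamma> b - \<gamma> a)) {a..b}"
proof (rule fundamental_theorem_of_calculus[OF assms(3)])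
  fix s
  assume "s \<in> {a..b}"
  then show "(\<gamma> has_vector_derivative \<gamma>' s) (at s within {a..b})"
    using assms unfolding c1_curve_def
    by (meson atLeastAtMost_iff atLeastatMost_subset_iff has_vector_derivative_within_subset order_trans)
qed

lemma partial_derivatives:
  assumes "(F has_derivative D) (at (x, u))"
  shows "((\<lambda>x'. F (x', u)) has_derivative (\<lambda>v. D (v, 0))) (at x)"
    and "((\<lambda>u'. F (x, u')) has_derivative (\<lambda>v. D (0, v))) (at u)"
proof -
  show "((\<lambda>x'. F (x', u)) has_derivative (\<lambda>v. D (v, 0))) (at x)"
    by (rule has_derivative_compose[of "\<lambda>x'. (x', u)" "\<lambda>v. (v, 0)" x UNIV F D])
      (use assms in \<open>auto intro!: derivative_eq_intros\<close>)
  show "((\<lambda>u'. F (x, u')) has_derivative (\<lambda>v. D (0, v))) (at u)"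
    by (rule has_derivative_compose[of "\<lambda>u'. (x, u')" "\<lambda>v. (0, v)" u UNIV F D])
      (use assms in \<open>auto intro!: derivative_eq_intros\<close>)
qed

lemma has_derivative_split_Pair:
  assumes "(F has_derivative D) (at p)"
  shows "D (a, b) = D (a, 0) + D (0, b)"
  using linear_add[OF has_derivative_linear[OF assms], of "(a, 0)" "(0, b)"] by simp

lemma jacobian_mult:
  fixes F :: "real^'a \<Rightarrow> real^'b"
  shows "(F has_derivative D) (at x) \<Longrightarrow> jacobian F (at x) *v v = D v"
  using fun_cong[OF matrix_vector_mul(2)[OF has_derivative_linear], of F D "at x" v]
  by (simp add: jacobian_def frechet_derivative_at[symmetric])

lemma grad_inner:
  assumes "(F has_derivative D) (at x)"
  shows "grad F x \<bullet> v = D v"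
proof -
  have lin: "linear D" using assms by (rule has_derivative_linear)
  have "D v = D (\<Sum>i\<in>UNIV. (v $ i) *\<^sub>R axis i 1)"
    by (rule arg_cong[of _ _ D]) (auto simp: vec_eq_iff axis_def if_distrib cong: if_cong)
  also have "\<dots> = grad F x \<bullet> v"
    by (simp add: grad_def frechet_derivative_at[OF assms, symmetric] inner_vec_def linear_sum[OF lin]
        linear_cmul[OF lin] mult.commute)
  finally show ?thesis by simp
qed

text \<open>A geodesic lifted by the feedback has velocity \<open>(v, K v)\<close>. The row
  assembled from partial gradients thus gives the rate of change of h_j along the lift;
  \<open>Acl_mult\<close> is the analogue for the predictor.\<close>

lemma hrow_inner:
  assumes "cont_diff (hcon pb j)"
  shows "hrow pb ds j x u \<bullet> v = frechet_derivative (hcon pb j) (at (x, u)) (v, Kfb ds x *v v)"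
proof -
  note D = cont_diff_has_derivative[OF assms, of "(x, u)"]
  show ?thesis
    by (simp add: hrow_def inner_add_left dot_lmul_matrix grad_inner[OF partial_derivatives(1)[OF D]]
        grad_inner[OF partial_derivatives(2)[OF D]] flip: has_derivative_split_Pair[OF D])
qed

lemma Acl_mult:
  assumes "cont_diff (\<lambda>p. fw pb md (fst p) (snd p) w)"
  shows "Acl pb md ds x u w *v v
    = frechet_derivative (\<lambda>p. fw pb md (fst p) (snd p) w) (at (x, u)) (v, Kfb ds x *v v)"
proof -
  note D = cont_diff_has_derivative[OF assms, of "(x, u)"]
  note P = partial_derivatives[OF D, simplified]
  show ?thesis
    by (simp add: Acl_def matrix_vector_mult_add_rdistrib jacobian_mult[OF P(1)] jacobian_mult[OF P(2)]
        flip: has_derivative_split_Pair[OF D] matrix_vector_mul_assoc)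
qed

section \<open>Kronecker structure and smoothness of the predictor\<close>

lemma sum_UNIV_sum: "(\<Sum>c\<in>UNIV. f (c :: 'a::finite + 'b::finite)) = (\<Sum>a\<in>UNIV. f (Inl a)) + (\<Sum>b\<in>UNIV. f (Inr b))"
  by (subst UNIV_Plus_UNIV[symmetric], subst sum.Plus) simp_all

lemma sum_UNIV_prod: "(\<Sum>c\<in>UNIV. f (c :: 'a::finite \<times> 'b::finite)) = (\<Sum>a\<in>UNIV. \<Sum>b\<in>UNIV. f (a, b))"
  by (simp flip: UNIV_Times_UNIV add: sum.cartesian_product)

text \<open>The mixed-product rule
  \<open>(y^T \<otimes> I) (v \<otimes> z) = (y \<bullet> v) z\<close>, applied to both
  blocks.\<close>

lemma Emat_mult_vstack:
  fixes pb :: "('n::finite, 'm::finite, 'l::finite, 'c::finite) plant"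
  shows "Emat pb md x u *v vstack (kron_vec wp wx) (kron_vec wu wx)
    = (cx md * (Phihat pb x \<bullet> wp) + cu md * (u \<bullet> wu)) *\<^sub>R wx"
proof -
  have *: "(\<Sum>a\<in>UNIV. \<Sum>b\<in>UNIV. c * (y $ a * mat 1 $ r $ b) * (v $ a * wx $ b)) = c * (y \<bullet> v) * wx $ r"
    for c and y v :: "real^'z" and r
  proof -
    have "(\<Sum>b\<in>UNIV. c * (y $ a * mat 1 $ r $ b) * (v $ a * wx $ b)) = c * (y $ a * v $ a) * wx $ r" for a
      by (subst sum.mono_neutral_right[of UNIV "{r}"]) (auto simp: mat_def)
    then show ?thesis by (simp add: inner_vec_def sum_distrib_left sum_distrib_right)
  qed
  have "(Emat pb md x u *v vstack (kron_vec wp wx) (kron_vec wu wx)) $ r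
    = (\<Sum>a\<in>UNIV. \<Sum>b\<in>UNIV. cx md * (Phihat pb x $ a * mat 1 $ r $ b) * (wp $ a * wx $ b))
    + (\<Sum>a\<in>UNIV. \<Sum>b\<in>UNIV. cu md * (u $ a * mat 1 $ r $ b) * (wu $ a * wx $ b))" for r
    unfolding matrix_vector_mult_def
    by (simp only: vec_lambda_beta sum_UNIV_sum[where 'a = "('n + 'l) \<times> 'n" and 'b = "'m \<times> 'n"] sum_UNIV_prod)
      (simp only: Emat_def hblock_def vstack_def kron_row_def kron_vec_def vec_lambda_beta sum.case
        vector_scaleR_component real_scaleR_def fst_conv snd_conv)
  then show ?thesis
    by (simp add: vec_eq_iff * distrib_right)
qed

lemma cont_diff_Phihat:
  assumes "lifting_ok pb"
  shows "cont_diff (Phihat pb)"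
proof (rule cont_diff_vec)
  fix i
  show "cont_diff (\<lambda>p. Phihat pb p $ i)"
    using assms by (cases i) (auto simp: Phihat_def vstack_def lifting_ok_def
        intro!: cont_diff_bounded_linear bounded_linear_vec_nth)
qed

lemma Phihat_zero: "lifting_ok pb \<Longrightarrow> Phihat pb 0 = 0"
  by (auto simp: Phihat_def vstack_def lifting_ok_def vec_eq_iff split: sum.split)

lemma Fhat_zero: "lifting_ok pb \<Longrightarrow> Fhat pb md 0 0 = 0"
  by (simp add: Fhat_def Lmap_def Phihat_zero)

lemma cont_diff_fw:
  assumes "lifting_ok pb" "w \<in> Dset"
  shows "cont_diff (\<lambda>p. fw pb md (fst p) (snd p) w)"
proof -
  obtain wp wu wx where w: "w = vstack (kron_vec wp wx) (kron_vec wu wx)"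
    using assms(2) by (auto simp: Dset_def)
  have Z: "cont_diff (\<lambda>p. Phihat pb (fst p))"
    by (rule cont_diff_comp_linear[OF bounded_linear_fst cont_diff_Phihat[OF assms(1)]])
  have U: "cont_diff (\<lambda>p. snd p)" by (rule cont_diff_bounded_linear[OF bounded_linear_snd])
  show ?thesis
    unfolding fw_def w Emat_mult_vstack Fhat_def Lmap_def
    by (intro cont_diff_add cont_diff_scaleR cont_diff_sum cont_diff_const
        cont_diff_linear_comp[OF matrix_vector_mul_bounded_linear] Z U
        cont_diff_linear_comp[OF bounded_linear_vec_nth]
        cont_diff_linear_comp[OF bounded_linear_mult_right]
        cont_diff_linear_comp[OF bounded_linear_inner_left])
qed


section \<open>Contraction along lifted geodesics\<close>

text \<open>One outcome of the data for which the certificate holds, together with one design; all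
  arguments inside are deterministic.\<close>

locale tube_mpc =
  fixes pb :: "('n::{finite,linorder}, 'm::finite, 'l::finite, 'c::finite) plant"
    and md :: "('n, 'm, 'l) model" and ds :: "('n, 'm) design"
  assumes system: "system_ok pb"
    and lifting: "lifting_ok pb"
    and nonneg: "0 \<le> cx md" "0 \<le> cu md"
    and xi_le: "\<And>x u. x \<in> Xset pb \<Longrightarrow> u \<in> Uset pb \<Longrightarrow>
      norm (xi pb md x u) \<le> cx md * norm (Phihat pb x) + cu md * norm u"
    and design: "design_ok ds"
    and rccm: "rccm pb md ds"
    and zero_tightening: "zero_tightening_ok pb ds"
begin

abbreviation "M \<equiv> Mmet ds"
abbreviation "K \<equiv> Kfb ds"
abbreviation "V \<equiv> Vdist M"

lemma cont_diff_hcon: "cont_diff (hcon pb j)"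
  using system by (simp add: system_ok_def)

lemma M_pd: "pd (M x)"
  and M_continuous: "continuous_on UNIV M"
  and K_continuous: "continuous_on UNIV K"
  and rho: "0 < rho ds" "rho ds < 1"
  and alpha: "0 < alpha1 ds" "0 < alpha2 ds"
  using rccm by (auto simp: rccm_def cont_diff_continuous_on)

lemma V_nonneg: "0 \<le> V x xb"
  by (rule Vdist_nonneg[OF M_pd])

text \<open>An instance for the quantifier over \<open>w\<close> in \<open>rccm\<close>, through
  which the lower metric bound at points of \<open>Zset pb\<close> is read off.\<close>

lemma zero_in_Dset: "0 \<in> (Dset :: ('n, 'm, 'l) disturbance set)"
proof -
  have "(0 :: ('n, 'm, 'l) disturbance) = vstack (kron_vec 0 0) (kron_vec 0 0)"
    by (auto simp: vec_eq_iff vstack_def kron_vec_def split: sum.split)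
  then show ?thesis by (force simp: Dset_def)
qed

lemma contraction:
  assumes "(x, u) \<in> Zset pb" "w \<in> Dset"
  shows "wnorm (M (fw pb md x u w)) (Acl pb md ds x u w *v v) \<le> sqrt (1 - rho ds) * wnorm (M x) v"
    and "sqrt (alpha1 ds) * norm v \<le> wnorm (M x) v"
    and "wnorm (M (fw pb md x u w)) v \<le> sqrt (alpha2 ds) * norm v"
    and "loewner_le (mat (alpha1 ds)) (M x)"
proof -
  have *: "loewner_le (transpose (Acl pb md ds x u w) ** M (fw pb md x u w) ** Acl pb md ds x u w)
        ((1 - rho ds) *\<^sub>R M x)"
    "loewner_le (mat (alpha1 ds)) (M x)" "loewner_le (M (fw pb md x u w)) (mat (alpha2 ds))"
    using rccm assms by (auto simp: rccm_def Let_def)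
  show "wnorm (M (fw pb md x u w)) (Acl pb md ds x u w *v v) \<le> sqrt (1 - rho ds) * wnorm (M x) v"
    using wnorm_mono[OF *(1), of v] by (simp only: wnorm_congruence wnorm_scaleR_matrix)
  show "sqrt (alpha1 ds) * norm v \<le> wnorm (M x) v"
    using wnorm_mono[OF *(2), of v] by (simp add: wnorm_mat)
  show "wnorm (M (fw pb md x u w)) v \<le> sqrt (alpha2 ds) * norm v"
    using wnorm_mono[OF *(3), of v] by (simp add: wnorm_mat)
qed (use rccm assms in \<open>auto simp: rccm_def Let_def\<close>)

section \<open>Constraint derivatives and tightening constants\<close>

lemma Zset_zero: "(0, 0) \<in> Zset pb"
  using system by (auto simp: system_ok_def Zset_def less_imp_le)

lemma Zset_D: "(x, u) \<in> Zset pb \<Longrightarrow> x \<in> Xset pb \<and> u \<in> Uset pb"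
  using system by (auto simp: system_ok_def)

lemma hrow_continuous: "continuous_on UNIV (\<lambda>p. hrow pb ds j (fst p) (snd p))"
proof (subst continuous_on_componentwise, intro ballI)
  fix b :: "(real, 'n) vec"
  have "continuous_on UNIV (\<lambda>p. (b, K (fst p) *v b))"
    unfolding matrix_vector_mult_def
    by (intro continuous_intros continuous_on_compose2[OF K_continuous]) auto
  then have "continuous_on UNIV (\<lambda>p. frechet_derivative (hcon pb j) (at p) (b, K (fst p) *v b))"
    by (intro continuous_on_frechet_derivative cont_diff_hcon continuous_on_id)
  then show "continuous_on UNIV (\<lambda>p. hrow pb ds j (fst p) (snd p) \<bullet> b)"
    by (simp add: hrow_inner[OF cont_diff_hcon])
qed

text \<open>A supremum dominates its members only if the set is bounded above: the rows are bounded
  on the compact set \<open>Zset pb\<close>, and the inverse Cholesky factor costs at most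
  \<open>1 / sqrt (alpha1 ds)\<close>.\<close>

lemma ctight_upper:
  assumes "(x, u) \<in> Zset pb"
  shows "norm (hrow pb ds j x u v* matrix_inv (chol (M x))) \<le> ctight pb ds j"
proof -
  have "compact ((\<lambda>p. hrow pb ds j (fst p) (snd p)) ` Zset pb)"
    using system hrow_continuous by (intro compact_continuous_image) (auto simp: system_ok_def intro: continuous_on_subset)
  then obtain B where B: "\<And>p. p \<in> Zset pb \<Longrightarrow> norm (hrow pb ds j (fst p) (snd p)) \<le> B"
    by (meson bounded_iff compact_imp_bounded imageI)
  have "norm (hrow pb ds j x u v* matrix_inv (chol (M x))) \<le> B / sqrt (alpha1 ds)" if "(x, u) \<in> Zset pb" for x u
  proof -
    have "norm (hrow pb ds j x u v* matrix_inv (chol (M x))) \<le> norm (hrow pb ds j x u) / sqrt (alpha1 ds)"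
      by (rule norm_row_chol_le[OF M_pd alpha(1) contraction(4)[OF that zero_in_Dset]])
    also have "\<dots> \<le> B / sqrt (alpha1 ds)"
      using B[OF that] alpha by (auto intro: divide_right_mono)
    finally show ?thesis .
  qed
  then have "bdd_above ((\<lambda>(x, u). norm (hrow pb ds j x u v* matrix_inv (chol (M x)))) ` Zset pb)"
    by (intro bdd_aboveI2[of _ _ "B / sqrt (alpha1 ds)"]) auto
  from cSUP_upper[OF assms this] show ?thesis by (simp add: ctight_def)
qed

lemma ctight_nonneg: "0 \<le> ctight pb ds j"
  using ctight_upper[OF Zset_zero] norm_ge_zero order_trans by blast

lemma hcon_derivative_le:
  assumes "(x, u) \<in> Zset pb"
  shows "frechet_derivative (hcon pb j) (at (x, u)) (v, K x *v v) \<le> ctight pb ds j * wnorm (M x) v"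
proof -
  have "hrow pb ds j x u \<bullet> v \<le> norm (hrow pb ds j x u v* matrix_inv (chol (M x))) * wnorm (M x) v"
    by (rule inner_le_wnorm[OF M_pd])
  also have "\<dots> \<le> ctight pb ds j * wnorm (M x) v"
    by (intro mult_right_mono ctight_upper assms wnorm_nonneg M_pd)
  finally show ?thesis by (simp add: hrow_inner[OF cont_diff_hcon])
qed

text \<open>The design supplies a minimizer, so the infimum \<open>V\<close> is attained; the lift
  is \<open>gamma_u\<close>, differentiable because its integrand is continuous.\<close>

lemma lifted_geodesic:
  obtains \<gamma> \<gamma>' \<eta> where "c1_curve \<gamma> \<gamma>'" "c1_curve \<eta> (\<lambda>s. K (\<gamma> s) *v \<gamma>' s)"
    "\<gamma> 0 = xb" "\<gamma> 1 = x" "\<eta> 0 = ub" "\<eta> 1 = kappa ds x xb ub"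
    "integral {0..1} (\<lambda>s. wnorm (M (\<gamma> s)) (\<gamma>' s)) = V x xb"
proof -
  define \<gamma> where "\<gamma> = geo ds xb x"
  define \<gamma>' where "\<gamma>' s = vector_derivative \<gamma> (at s)" for s
  have geod: "geodesic M xb x \<gamma>" using design by (simp add: design_ok_def \<gamma>_def)
  then have C: "\<gamma> \<in> Curves xb x" and min: "\<And>g. g \<in> Curves xb x \<Longrightarrow> curve_length M \<gamma> \<le> curve_length M g"
    by (auto simp: geodesic_def)
  \<comment> \<open>The derivative granted by the curve class is identified with
    \<open>vector_derivative\<close>, which occurs in \<open>curve_length\<close> and
    \<open>gamma_u\<close>.\<close>
  obtain D where D: "\<And>s. s \<in> {0..1} \<Longrightarrow> (\<gamma> has_vector_derivative D s) (at s)" "continuous_on {0..1} D"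
    using C unfolding Curves_def C1_differentiable_on_def by blast
  have "D s = \<gamma>' s" if "s \<in> {0..1}" for s
    using vector_derivative_at[OF D(1)[OF that]] by (simp add: \<gamma>'_def)
  then have D': "\<And>s. s \<in> {0..1} \<Longrightarrow> (\<gamma> has_vector_derivative \<gamma>' s) (at s)" "continuous_on {0..1} \<gamma>'"
    using D continuous_on_cong[of "{0..1}" "{0..1}" D \<gamma>'] by simp_all
  then have g: "c1_curve \<gamma> \<gamma>'"
    unfolding c1_curve_def by (blast intro: has_vector_derivative_at_within)
  define \<eta> where "\<eta> = gamma_u ds x xb ub"
  have "continuous_on {0..1} (\<lambda>s. K (\<gamma> s) *v \<gamma>' s)"
    unfolding matrix_vector_mult_def using g c1_curve_continuous[OF g]
    by (intro continuous_intros continuous_on_compose2[OF K_continuous]) (auto simp: c1_curve_def)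
  then have h: "c1_curve \<eta> (\<lambda>s. K (\<gamma> s) *v \<gamma>' s)"
    unfolding c1_curve_def \<eta>_def gamma_u_def[abs_def]
    by (auto simp: \<gamma>_def[symmetric] \<gamma>'_def[symmetric]
        intro!: derivative_eq_intros integral_has_vector_derivative)
  have "curve_length M \<gamma> = V x xb"
    unfolding Vdist_def
  proof (rule antisym)
    show "curve_length M \<gamma> \<le> (INF g\<in>Curves xb x. curve_length M g)"
      by (rule cINF_greatest) (use C min in auto)
    show "(INF g\<in>Curves xb x. curve_length M g) \<le> curve_length M \<gamma>"
      by (rule cINF_lower[OF _ C]) (auto intro!: bdd_belowI2[of _ 0] curve_length_nonneg M_pd)
  qed
  then have "integral {0..1} (\<lambda>s. wnorm (M (\<gamma> s)) (\<gamma>' s)) = V x xb"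
    by (simp add: curve_length_def \<gamma>'_def)
  moreover have "\<gamma> 0 = xb" "\<gamma> 1 = x" using C by (auto simp: Curves_def)
  moreover have "\<eta> 0 = ub" "\<eta> 1 = kappa ds x xb ub" by (auto simp: \<eta>_def gamma_u_def kappa_def)
  ultimately show ?thesis using that g h by blast
qed

lemma continuous_on_wnorm_curve:
  "c1_curve \<gamma> \<gamma>' \<Longrightarrow> continuous_on {0..1} (\<lambda>s. wnorm (M (\<gamma> s)) (\<gamma>' s))"
  using c1_curve_continuous[of \<gamma> \<gamma>']
  by (auto simp: c1_curve_def intro!: continuous_on_wnorm continuous_on_compose2[OF M_continuous])

text \<open>Continuation at the infimum \<open>s\<close> of the times spent outside \<open>Z\<close>. If \<open>c\<^sub>j > 0\<close>, then \<open>h\<^sub>j < 0\<close> at \<open>s\<close>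
  unless the remaining curve has length 0 and is constant; if \<open>c\<^sub>j = 0\<close>, then \<open>h\<^sub>j\<close> is constant near \<open>s\<close>.\<close>

lemma lifted_curve_in_Zset:
  assumes g: "c1_curve \<gamma> \<gamma>'" and h: "c1_curve \<eta> (\<lambda>s. K (\<gamma> s) *v \<gamma>' s)"
    and tight: "\<And>j. hcon pb j (\<gamma> 0, \<eta> 0)
      + ctight pb ds j * integral {0..1} (\<lambda>s. wnorm (M (\<gamma> s)) (\<gamma>' s)) \<le> 0"
    and t: "t \<in> {0..1}"
  shows "(\<gamma> t, \<eta> t) \<in> Zset pb"
proof (rule ccontr)
  assume bad: "(\<gamma> t, \<eta> t) \<notin> Zset pb"
  define p where "p s = (\<gamma> s, \<eta> s)" for s
  define w where "w s = wnorm (M (\<gamma> s)) (\<gamma>' s)" for s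
  define h' where "h' j s = frechet_derivative (hcon pb j) (at (p s)) (\<gamma>' s, K (\<gamma> s) *v \<gamma>' s)" for j s
  have h'_eq: "h' j s = hrow pb ds j (\<gamma> s) (\<eta> s) \<bullet> \<gamma>' s" for j s
    by (simp add: h'_def p_def hrow_inner[OF cont_diff_hcon])
  have p: "c1_curve p (\<lambda>s. (\<gamma>' s, K (\<gamma> s) *v \<gamma>' s))"
    unfolding p_def[abs_def] by (rule c1_curve_Pair[OF g h])
  note p_cont = c1_curve_continuous[OF p]
  have hp: "c1_curve (\<lambda>s. hcon pb j (p s)) (h' j)" for j
    unfolding h'_def[abs_def] by (rule c1_curve_comp[OF cont_diff_hcon p])
  note hp_cont = c1_curve_continuous[OF hp]
  have w_cont: "continuous_on {0..1} w" unfolding w_def[abs_def] by (rule continuous_on_wnorm_curve[OF g])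
  have w_int: "w integrable_on {a..b}" if "0 \<le> a" "b \<le> 1" for a b
    using that by (intro integrable_continuous_interval continuous_on_subset[OF w_cont]) auto
  have w0: "0 \<le> w s" for s by (simp add: w_def wnorm_nonneg M_pd)
  define L where "L = integral {0..1} w"
  have tight: "hcon pb j (p 0) \<le> - ctight pb ds j * L" for j
    using tight[of j] by (simp add: p_def L_def w_def[abs_def])
  have L0: "0 \<le> L" unfolding L_def by (rule integral_nonneg[OF w_int]) (auto simp: w0)
  define B where "B = {s \<in> {0..1}. p s \<notin> Zset pb}"
  define s where "s = Inf B"
  have B: "t \<in> B" "bdd_below B" using t bad by (auto simp: B_def p_def intro!: bdd_belowI[of _ 0])
  have s_le: "s \<le> b" if "b \<in> B" for b using cInf_lower[OF that B(2)] by (simp add: s_def)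
  have s0: "0 \<le> s" unfolding s_def by (rule cInf_greatest) (use B in \<open>auto simp: B_def\<close>)
  have before: "p r \<in> Zset pb" if "0 \<le> r" "r < s" for r
    using that s_le[of r] s_le[OF B(1)] t by (force simp: B_def)
  \<comment> \<open>For \<open>s > 0\<close> each h_j is at most 0 on the earlier times and hence in
    the limit; for \<open>s = 0\<close> the tightened constraint itself applies.\<close>
  have ps: "p s \<in> Zset pb"
  proof (cases "s = 0")
    case True
    have "hcon pb j (p 0) \<le> 0" for j
      using tight[of j] mult_nonneg_nonneg[OF ctight_nonneg L0, of j] by linarith
    then show ?thesis by (simp add: True Zset_def)
  next
    case False
    have "hcon pb j (p s) \<le> 0" for j
    proof (rule continuous_le_on_closure[where S = "{0..<s}" and f = "\<lambda>s. hcon pb j (p s)"])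
      show "continuous_on (closure {0..<s}) (\<lambda>s. hcon pb j (p s))"
        using False s0 s_le[OF B(1)] t by (auto intro: continuous_on_subset[OF hp_cont])
    qed (use False s0 before in \<open>auto simp: Zset_def\<close>)
    then show ?thesis by (simp add: Zset_def)
  qed
  then have s1: "s < 1" using s_le[OF B(1)] B(1) t by (cases "s = t") (auto simp: B_def)
  have "\<forall>\<^sub>F r in at s within {s..1}. hcon pb j (p r) \<le> 0" for j
  proof -
    have cont_s: "continuous_on {s..1} (\<lambda>s. hcon pb j (p s))" "continuous_on {s..1} p"
      using s0 by (auto intro: continuous_on_subset[OF hp_cont] continuous_on_subset[OF p_cont])
    have s_mem: "s \<in> {s..1}" using s1 by simp
    \<comment> \<open>Serves both degenerate cases: zero tightening, and no length left.\<close>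
    have const: "hcon pb j (p r) \<le> 0" if r: "s \<le> r" "r \<le> 1" "\<And>q. q \<in> {s..r} \<Longrightarrow> h' j q = 0" for r
    proof -
      have "(h' j has_integral 0) {s..r}" by (rule has_integral_is_0) (use r(3) in auto)
      from has_integral_unique[OF c1_curve_has_integral[OF hp s0 r(1,2)] this]
      have "hcon pb j (p r) = hcon pb j (p s)" by simp
      then show ?thesis using ps by (simp add: Zset_def)
    qed
    show ?thesis
    proof (cases "ctight pb ds j = 0")
      case True
      then obtain W where W: "open W" "Zset pb \<subseteq> W" "\<And>x u. (x, u) \<in> W \<Longrightarrow> hrow pb ds j x u = 0"
        using zero_tightening by (force simp: zero_tightening_ok_def)
      have "(p \<longlongrightarrow> p s) (at s within {s..1})" using cont_s(2) s_mem by (auto simp: continuous_on_def)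
      from topological_tendstoD[OF this W(1)] W(2) ps
      have "\<forall>\<^sub>F r in at s within {s..1}. p r \<in> W" by blast
      then obtain d where d: "0 < d" "\<And>r. r \<in> {s..1} \<Longrightarrow> r \<noteq> s \<Longrightarrow> dist r s < d \<Longrightarrow> p r \<in> W"
        by (auto simp: eventually_at)
      have "hcon pb j (p r) \<le> 0" if "r \<in> {s..1}" "dist r s < d" for r
      proof (rule const)
        fix q assume q: "q \<in> {s..r}"
        then have "p q \<in> W" using that d(2)[of q] W(2) ps by (cases "q = s") (auto simp: dist_real_def)
        then show "h' j q = 0"
          using W(3)[of "\<gamma> q" "\<eta> q"] by (simp add: h'_eq p_def)
      qed (use that in auto)
      then show ?thesis using d(1) by (auto simp: eventually_at)
    next
      case False
      then have c: "0 < ctight pb ds j" using ctight_nonneg[of j] by simp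
      \<comment> \<open>Up to \<open>s\<close> the curve is in Z, so h_j has grown by at most c_j
        times the length used so far; the tightening at 0 leaves a slack of c_j times the remaining
        length.\<close>
      have "hcon pb j (p s) - hcon pb j (p 0) \<le> ctight pb ds j * integral {0..s} w"
      proof (rule has_integral_le[OF c1_curve_has_integral[OF hp]])
        show "((\<lambda>s. ctight pb ds j * w s) has_integral ctight pb ds j * integral {0..s} w) {0..s}"
          using s1 by (intro has_integral_mult_right integrable_integral w_int) auto
        show "h' j r \<le> ctight pb ds j * w r" if "r \<in> {0..s}" for r
        proof -
          have "(\<gamma> r, \<eta> r) \<in> Zset pb" using that before[of r] ps by (cases "r = s") (auto simp: p_def)
          then show ?thesis unfolding h'_def w_def p_def by (rule hcon_derivative_le)
        qed
      qed (use s0 s1 in auto)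
      then have hs: "hcon pb j (p s) \<le> ctight pb ds j * (integral {0..s} w - L)"
        using tight[of j] by (simp add: algebra_simps)
      have split: "integral {0..s} w + integral {s..1} w = L"
        unfolding L_def using s0 s1 by (intro Henstock_Kurzweil_Integration.integral_combine w_int) auto
      show ?thesis
      proof (cases "integral {s..1} w > 0")
        case True
        then have "integral {0..s} w - L < 0" using split by simp
        then have "hcon pb j (p s) < 0" using hs mult_pos_neg[OF c] by fastforce
        have "((\<lambda>r. hcon pb j (p r)) \<longlongrightarrow> hcon pb j (p s)) (at s within {s..1})"
          using cont_s(1) s_mem by (auto simp: continuous_on_def)
        from order_tendstoD(2)[OF this \<open>hcon pb j (p s) < 0\<close>] show ?thesis by (rule eventually_mono) simp
      next
        case False
        moreover have "0 \<le> integral {s..1} w" by (rule integral_nonneg[OF w_int]) (auto simp: s0 w0)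
        ultimately have "integral {s..1} w = 0" by simp
        then have "w q = 0" if "q \<in> {s..1}" for q
          using integral_eq_0_iff[of s 1 w] s0 s1 w0 that continuous_on_subset[OF w_cont, of "{s..1}"] by auto
        then have "h' j q = 0" if "q \<in> {s..1}" for q
          using that by (simp add: w_def wnorm_eq_0_iff M_pd h'_eq)
        then show ?thesis by (auto simp: eventually_at intro!: exI[of _ 1] const)
      qed
    qed
  qed
  then have "\<forall>\<^sub>F r in at s within {s..1}. p r \<in> Zset pb"
    by (simp add: Zset_def eventually_all_finite)
  then obtain d where d: "0 < d" "\<And>r. r \<in> {s..1} \<Longrightarrow> r \<noteq> s \<Longrightarrow> dist r s < d \<Longrightarrow> p r \<in> Zset pb"
    by (auto simp: eventually_at)
  \<comment> \<open>The radius \<open>d\<close> serves all finitely many constraints at once, while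
    the infimum has members of \<open>B\<close> arbitrarily close after it.\<close>
  obtain b where b: "b \<in> B" "b < s + d"
    using cInf_lessD[of B "s + d"] B d(1) by (auto simp: s_def)
  then have "p b \<in> Zset pb"
    using d(2)[of b] s_le[of b] ps by (cases "b = s") (auto simp: B_def dist_real_def)
  then show False using b(1) by (simp add: B_def)
qed

text \<open>The true state and the applied input form the endpoint of the lifted geodesic.\<close>

lemma kappa_in_Zset:
  assumes "\<And>j. hcon pb j (xb, ub) + ctight pb ds j * V x xb \<le> 0"
  shows "(x, kappa ds x xb ub) \<in> Zset pb"
proof -
  obtain \<gamma> \<gamma>' \<eta> where g: "c1_curve \<gamma> \<gamma>'" "c1_curve \<eta> (\<lambda>s. K (\<gamma> s) *v \<gamma>' s)"
    "\<gamma> 0 = xb" "\<gamma> 1 = x" "\<eta> 0 = ub" "\<eta> 1 = kappa ds x xb ub"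
    "integral {0..1} (\<lambda>s. wnorm (M (\<gamma> s)) (\<gamma>' s)) = V x xb"
    by (rule lifted_geodesic[of xb x ub])
  then show ?thesis using lifted_curve_in_Zset[OF g(1,2), of 1] assms by simp
qed

text \<open>The metric dominates the Euclidean norm only over Z. The tightened constraint keeps the
  geodesic there, so its Euclidean displacement can be integrated.\<close>

lemma norm_diff_le_V:
  assumes "\<And>j. hcon pb j (xb, ub) + ctight pb ds j * V x xb \<le> 0"
  shows "sqrt (alpha1 ds) * norm (x - xb) \<le> V x xb"
proof -
  obtain \<gamma> \<gamma>' \<eta> where g: "c1_curve \<gamma> \<gamma>'" "c1_curve \<eta> (\<lambda>s. K (\<gamma> s) *v \<gamma>' s)"
    "\<gamma> 0 = xb" "\<gamma> 1 = x" "\<eta> 0 = ub" and len: "integral {0..1} (\<lambda>s. wnorm (M (\<gamma> s)) (\<gamma>' s)) = V x xb"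
    by (rule lifted_geodesic[of xb x ub])
  have w: "(\<lambda>s. wnorm (M (\<gamma> s)) (\<gamma>' s)) integrable_on {0..1}"
    by (rule integrable_continuous_interval[OF continuous_on_wnorm_curve[OF g(1)]])
  have "norm (x - xb) = norm (integral {0..1} \<gamma>')"
    using integral_unique[OF c1_curve_has_integral[OF g(1), of 0 1]] g by simp
  also have "\<dots> \<le> integral {0..1} (\<lambda>s. wnorm (M (\<gamma> s)) (\<gamma>' s) / sqrt (alpha1 ds))"
  proof (rule integral_norm_bound_integral)
    show "\<gamma>' integrable_on {0..1}" using g(1) by (auto simp: c1_curve_def intro: integrable_continuous_interval)
    show "(\<lambda>s. wnorm (M (\<gamma> s)) (\<gamma>' s) / sqrt (alpha1 ds)) integrable_on {0..1}"
      by (rule integrable_on_divide[OF w])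
    fix s :: real assume "s \<in> {0..1}"
    then have "(\<gamma> s, \<eta> s) \<in> Zset pb" using lifted_curve_in_Zset[OF g(1,2)] g len assms by auto
    from contraction(2)[OF this zero_in_Dset, of "\<gamma>' s"] alpha(1)
    show "norm (\<gamma>' s) \<le> wnorm (M (\<gamma> s)) (\<gamma>' s) / sqrt (alpha1 ds)" by (simp add: field_simps)
  qed
  also have "\<dots> = V x xb / sqrt (alpha1 ds)" by (simp add: len)
  finally show ?thesis using alpha(1) by (simp add: field_simps)
qed

text \<open>With unit vectors along \<open>Phihat pb x\<close> and \<open>u\<close>, the matrix
  \<open>E\<close> multiplies \<open>wx\<close> by exactly the certified bound \<open>b\<close>, so
  every error of norm at most \<open>b\<close> is reached. Scaling \<open>wx\<close> alone shows
  that the multiples \<open>t *\<^sub>R w\<close> are admissible too.\<close>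

lemma Fmap_eq_fw:
  assumes Z: "(x, u) \<in> Zset pb"
  obtains w where "w \<in> Dset" "\<And>t. t \<in> {0..1} \<Longrightarrow> t *\<^sub>R w \<in> Dset" "Fmap pb x u = fw pb md x u w"
proof -
  define b where "b = cx md * norm (Phihat pb x) + cu md * norm u"
  define e where "e = Fmap pb x u - Fhat pb md x u"
  have b0: "0 \<le> b" using nonneg by (simp add: b_def)
  \<comment> \<open>\<open>Fhat\<close> is the state block of \<open>Lmap\<close>, and the lifted
    successor begins with the state; \<open>e\<close> is therefore the state block of
    \<open>xi\<close>.\<close>
  have "e = (\<chi> i. xi pb md x u $ Inl i)"
  proof -
    have "hblock (mat 1) 0 *v z = (\<chi> i. z $ Inl i)" for z :: "(real, 'n + 'l) vec"
      by (simp add: vec_eq_iff matrix_vector_mult_def hblock_def sum_UNIV_sum mat_def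
          if_distrib[where f = "\<lambda>x. x * _"] cong: if_cong)
    then show ?thesis by (simp add: e_def xi_def Fhat_def vec_eq_iff Phihat_def vstack_def)
  qed
  then have "norm e \<le> norm (xi pb md x u)"
    by (simp add: norm_vec_def L2_set_def sum_UNIV_sum sum_nonneg)
  also have "\<dots> \<le> b" using xi_le Zset_D[OF Z] by (simp add: b_def)
  finally have eb: "norm e \<le> b" .
  \<comment> \<open>For \<open>b = 0\<close> division by zero gives \<open>wx = 0\<close>, in
    accordance with \<open>e = 0\<close>.\<close>
  define wx where "wx = (1 / b) *\<^sub>R e"
  define w :: "('n, 'm, 'l) disturbance"
    where "w = vstack (kron_vec (sgn (Phihat pb x)) wx) (kron_vec (sgn u) wx)"
  have wx: "norm wx \<le> 1" using eb b0 by (auto simp: wx_def divide_simps)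
  have tw: "t *\<^sub>R w \<in> Dset" if "t \<in> {0..1}" for t
  proof -
    have "t *\<^sub>R w = vstack (kron_vec (sgn (Phihat pb x)) (t *\<^sub>R wx)) (kron_vec (sgn u) (t *\<^sub>R wx))"
      by (auto simp: w_def vec_eq_iff vstack_def kron_vec_def split: sum.split)
    moreover have "norm (t *\<^sub>R wx) \<le> 1" using wx that by (simp add: mult_le_one)
    moreover have "norm (sgn (Phihat pb x)) \<le> 1" "norm (sgn u) \<le> 1" by (simp_all add: norm_sgn)
    ultimately show ?thesis unfolding Dset_def mem_cball_0 by blast
  qed
  have inner_sgn: "z \<bullet> sgn z = norm z" for z :: "real^'z"
    by (cases "z = 0") (auto simp: sgn_div_norm dot_square_norm power2_eq_square)
  have "Emat pb md x u *v w = b *\<^sub>R wx"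
    by (simp add: w_def Emat_mult_vstack b_def inner_sgn)
  also have "\<dots> = e" using eb by (cases "b = 0") (auto simp: wx_def)
  finally have "Fmap pb x u = fw pb md x u w" by (simp add: fw_def e_def)
  then show ?thesis using that tw tw[of 1] by simp
qed

text \<open>Uniform in \<open>w\<close>: it covers a disturbance selected at the true state but
  evaluated at the nominal pair, so the tube recursion can be stated in nominal quantities.\<close>

lemma norm_Emat_mult_le:
  assumes "w \<in> Dset"
  shows "norm (Emat pb md x u *v w) \<le> cx md * norm (Phihat pb x) + cu md * norm u"
proof -
  obtain wp wu wx where w: "w = vstack (kron_vec wp wx) (kron_vec wu wx)"
    "norm wp \<le> 1" "norm wu \<le> 1" "norm wx \<le> 1"
    using assms by (auto simp: Dset_def)
  have le: "\<bar>z \<bullet> v\<bar> \<le> norm z" if "norm v \<le> 1" for z v :: "real^'z"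
    using Cauchy_Schwarz_ineq2[of z v] mult_left_mono[OF that, of "norm z"] by simp
  have "\<bar>cx md * (Phihat pb x \<bullet> wp) + cu md * (u \<bullet> wu)\<bar>
      \<le> cx md * \<bar>Phihat pb x \<bullet> wp\<bar> + cu md * \<bar>u \<bullet> wu\<bar>"
    by (rule order_trans[OF abs_triangle_ineq]) (simp add: abs_mult nonneg)
  also have "\<dots> \<le> cx md * norm (Phihat pb x) + cu md * norm u"
    by (intro add_mono mult_left_mono le w nonneg)
  finally have *: "\<bar>cx md * (Phihat pb x \<bullet> wp) + cu md * (u \<bullet> wu)\<bar> \<le> cx md * norm (Phihat pb x) + cu md * norm u" .
  have "norm (Emat pb md x u *v w) \<le> \<bar>cx md * (Phihat pb x \<bullet> wp) + cu md * (u \<bullet> wu)\<bar> * 1"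
    unfolding w(1) Emat_mult_vstack norm_scaleR by (intro mult_left_mono w) simp
  with * show ?thesis by simp
qed

text \<open>The true successor equals \<open>f\<^sub>w\<close> for one fixed disturbance \<open>w\<close>, and \<open>f\<^sub>w\<close> with this \<open>w\<close> contracts the
  lifted geodesic. The segment that scales \<open>w\<close> down to 0 joins its starting point to the nominal successor.\<close>

lemma V_next_le:
  assumes tight: "\<And>j. hcon pb j (xb, ub) + ctight pb ds j * V x xb \<le> 0"
  shows "V (Fmap pb x (kappa ds x xb ub)) (Fhat pb md xb ub) \<le> delta_next pb md ds xb ub (V x xb)"
proof -
  obtain \<gamma> \<gamma>' \<eta> where g: "c1_curve \<gamma> \<gamma>'" "c1_curve \<eta> (\<lambda>s. K (\<gamma> s) *v \<gamma>' s)"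
    "\<gamma> 0 = xb" "\<gamma> 1 = x" "\<eta> 0 = ub" "\<eta> 1 = kappa ds x xb ub"
    and len: "integral {0..1} (\<lambda>s. wnorm (M (\<gamma> s)) (\<gamma>' s)) = V x xb"
    by (rule lifted_geodesic[of xb x ub])
  have inZ: "(\<gamma> s, \<eta> s) \<in> Zset pb" if "s \<in> {0..1}" for s
    using lifted_curve_in_Zset[OF g(1,2)] g len tight that by auto
  then have Z0: "(xb, ub) \<in> Zset pb" using g(3,5) by force
  have "(x, kappa ds x xb ub) \<in> Zset pb" using inZ[of 1] g(4,6) by simp
  then obtain w where w: "w \<in> Dset" "\<And>t. t \<in> {0..1} \<Longrightarrow> t *\<^sub>R w \<in> Dset"
    "Fmap pb x (kappa ds x xb ub) = fw pb md x (kappa ds x xb ub) w"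
    by (rule Fmap_eq_fw) blast
  define E where "E = Emat pb md xb ub *v w"
  define \<gamma>1 where "\<gamma>1 s = Fhat pb md xb ub + s *\<^sub>R E" for s
  define \<gamma>2 where "\<gamma>2 s = fw pb md (\<gamma> s) (\<eta> s) w" for s
  define A where "A s = Acl pb md ds (\<gamma> s) (\<eta> s) w *v \<gamma>' s" for s
  have \<gamma>1: "c1_curve \<gamma>1 (\<lambda>_. E)" unfolding \<gamma>1_def[abs_def] by (rule c1_curve_segment)
  have \<gamma>2: "c1_curve \<gamma>2 A"
    using c1_curve_comp[OF cont_diff_fw[OF lifting w(1)] c1_curve_Pair[OF g(1,2)]]
    by (simp add: \<gamma>2_def[abs_def] A_def[abs_def] Acl_mult[OF cont_diff_fw[OF lifting w(1)]])
  have "V (\<gamma>2 1) (\<gamma>1 0) \<le> integral {0..1} (\<lambda>s. wnorm (M (\<gamma>1 s)) E)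
      + integral {0..1} (\<lambda>s. wnorm (M (\<gamma>2 s)) (A s))"
    by (rule Vdist_concat_le[OF M_continuous M_pd \<gamma>1 \<gamma>2]) (simp add: \<gamma>1_def \<gamma>2_def E_def fw_def g)
  also have "integral {0..1} (\<lambda>s. wnorm (M (\<gamma>1 s)) E)
      \<le> integral {0..1} (\<lambda>s::real. sqrt (alpha2 ds) * (cx md * norm (Phihat pb xb) + cu md * norm ub))"
  proof (rule integral_le[OF integrable_continuous_interval[OF continuous_on_wnorm_curve[OF \<gamma>1]]])
    fix s :: real assume s: "s \<in> {0..1}"
    \<comment> \<open>The upper metric bound is available at images of \<open>fw\<close>; the
      segment consists of such images because \<open>w\<close> may be scaled down.\<close>
    have "\<gamma>1 s = fw pb md xb ub (s *\<^sub>R w)"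
      by (simp add: \<gamma>1_def fw_def E_def matrix_vector_mult_scaleR)
    then have "wnorm (M (\<gamma>1 s)) E \<le> sqrt (alpha2 ds) * norm E"
      using contraction(3)[OF Z0 w(2)[OF s], of E] by simp
    also have "\<dots> \<le> sqrt (alpha2 ds) * (cx md * norm (Phihat pb xb) + cu md * norm ub)"
      unfolding E_def using alpha by (intro mult_left_mono norm_Emat_mult_le w) auto
    finally show "wnorm (M (\<gamma>1 s)) E \<le> sqrt (alpha2 ds) * (cx md * norm (Phihat pb xb) + cu md * norm ub)" .
  qed auto
  also have "integral {0..1} (\<lambda>s. wnorm (M (\<gamma>2 s)) (A s))
      \<le> integral {0..1} (\<lambda>s. sqrt (1 - rho ds) * wnorm (M (\<gamma> s)) (\<gamma>' s))"
  proof (rule integral_le[OF integrable_continuous_interval[OF continuous_on_wnorm_curve[OF \<gamma>2]]])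
    show "(\<lambda>s. sqrt (1 - rho ds) * wnorm (M (\<gamma> s)) (\<gamma>' s)) integrable_on {0..1}"
      by (intro integrable_continuous_interval continuous_on_mult_left continuous_on_wnorm_curve[OF g(1)])
    show "wnorm (M (\<gamma>2 s)) (A s) \<le> sqrt (1 - rho ds) * wnorm (M (\<gamma> s)) (\<gamma>' s)" if "s \<in> {0..1}" for s
      unfolding A_def \<gamma>2_def by (rule contraction(1)[OF inZ[OF that] w(1)])
  qed
  also have "\<dots> = sqrt (1 - rho ds) * V x xb" by (simp add: len)
  finally show ?thesis using w(3) g by (simp add: \<gamma>1_def \<gamma>2_def delta_next_def)
qed

end


section \<open>Recursive feasibility and stability\<close>

lemma wnorm_sgn: "wnorm P x = norm x * wnorm P (sgn x)"
  using wnorm_scaleR_vector[of P "norm x" "sgn x"] by (cases "x = 0") (auto simp: sgn_div_norm)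

text \<open>The constant is the square of the minimum of \<open>wnorm P\<close> over the unit
  sphere.\<close>

lemma pd_wnorm_lower:
  assumes P: "pd P"
  obtains q where "0 < q" "\<And>x. q * (norm x)\<^sup>2 \<le> (wnorm P x)\<^sup>2"
proof -
  have "continuous_on (sphere 0 1) (\<lambda>x. wnorm P x)"
    by (intro continuous_on_wnorm continuous_intros)
  then obtain y where y: "y \<in> sphere 0 1" "\<And>x. x \<in> sphere 0 1 \<Longrightarrow> wnorm P y \<le> wnorm P x"
    using continuous_attains_inf[of "sphere 0 1" "wnorm P"]
    by (metis compact_sphere sphere_eq_empty[of 0 1] not_one_less_zero)
  have w0: "0 < wnorm P y"
    using y(1) wnorm_nonneg[OF P, of y] wnorm_eq_0_iff[OF P, of y] by (cases "y = 0") auto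
  have "wnorm P y * norm x \<le> wnorm P x" for x
  proof (cases "x = 0")
    case False
    then show ?thesis
      using y(2)[of "sgn x"] by (subst (2) wnorm_sgn) (simp add: norm_sgn mult.commute mult_left_mono)
  qed simp
  then have "(wnorm P y)\<^sup>2 * (norm x)\<^sup>2 \<le> (wnorm P x)\<^sup>2" for x
    using power_mono[of "wnorm P y * norm x" "wnorm P x" 2] w0 by (simp add: power_mult_distrib)
  then show ?thesis using that w0 by (meson zero_less_power)
qed

lemma wnorm_bounded_on_compact:
  fixes P :: "'a::metric_space \<Rightarrow> real^'n^'n"
  assumes "compact S" "continuous_on S P"
  obtains m where "0 < m" "\<And>z v. z \<in> S \<Longrightarrow> wnorm (P z) v \<le> m * norm v"
proof -
  have "compact ((\<lambda>(z, v). wnorm (P z) v) ` (S \<times> sphere 0 1))"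
    unfolding case_prod_unfold
    by (intro compact_continuous_image continuous_on_wnorm continuous_on_snd continuous_on_id
        continuous_on_compose2[OF assms(2) continuous_on_fst] compact_Times assms compact_sphere) auto
  then obtain B where bd: "\<And>r. r \<in> (\<lambda>(z, v). wnorm (P z) v) ` (S \<times> sphere 0 1) \<Longrightarrow> norm r \<le> B"
    by (meson bounded_iff compact_imp_bounded)
  then have B: "wnorm (P z) v \<le> B" if "z \<in> S" "norm v = 1" for z v
  proof -
    have "wnorm (P z) v \<in> (\<lambda>(z, v). wnorm (P z) v) ` (S \<times> sphere 0 1)"
      using that by (auto intro!: rev_image_eqI[of "(z, v)"])
    then show ?thesis using bd[of "wnorm (P z) v"] by simp
  qed
  \<comment> \<open>The maximum with 1 makes the constant positive.\<close>
  have "wnorm (P z) v \<le> max 1 B * norm v" if z: "z \<in> S" for z v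
  proof (cases "v = 0")
    case False
    then show ?thesis
      using B[OF z, of "sgn v"] by (subst wnorm_sgn) (simp add: norm_sgn mult.commute mult_left_mono)
  qed simp
  then show ?thesis using that[of "max 1 B"] by simp
qed

lemma wnorm_bounded:
  obtains m where "0 < m" "\<And>v. wnorm P v \<le> m * norm v"
  by (rule wnorm_bounded_on_compact[of "{0::real}" "\<lambda>_. P"]) (use that in auto)

text \<open>The upper bound turns the decrease \<open>a * (x k)\<^sup>2\<close> into at least the
  fraction \<open>a / b\<close> of \<open>J k\<close>. The square root of the resulting bound on
  \<open>J\<close> gives both constants.\<close>

lemma geometric_decay:
  fixes J :: "nat \<Rightarrow> real"
  assumes "0 < a" "a < b" and low: "\<And>k. a * (x k)\<^sup>2 \<le> J k - J (Suc k)" and up: "\<And>k. J k \<le> b * (x k)\<^sup>2"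
    and "\<And>k. 0 \<le> J k" "\<And>k. 0 \<le> x k"
  shows "x k \<le> sqrt (b / a) * sqrt (1 - a / b) ^ k * x 0"
proof -
  have \<theta>: "0 < 1 - a / b" using assms by simp
  have "J (Suc k) \<le> (1 - a / b) * J k" for k
  proof -
    have "a / b * J k \<le> a / b * (b * (x k)\<^sup>2)" using assms by (intro mult_left_mono up) auto
    also have "\<dots> = a * (x k)\<^sup>2" using assms by simp
    finally show ?thesis using low[of k] by (simp add: left_diff_distrib)
  qed
  then have J: "J k \<le> (1 - a / b) ^ k * J 0" for k
  proof (induction k)
    case (Suc k)
    have "J (Suc k) \<le> (1 - a / b) * J k" by fact
    also have "\<dots> \<le> (1 - a / b) * ((1 - a / b) ^ k * J 0)"
      using \<theta> Suc by (intro mult_left_mono) auto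
    finally show ?case by (simp add: mult.assoc)
  qed simp
  have "a * (x k)\<^sup>2 \<le> J k" using low[of k] assms(5)[of "Suc k"] by simp
  also have "\<dots> \<le> (1 - a / b) ^ k * (b * (x 0)\<^sup>2)"
    using J[of k] up[of 0] \<theta> by (meson less_imp_le mult_left_mono order_trans zero_less_power)
  finally have "(x k)\<^sup>2 \<le> b / a * (1 - a / b) ^ k * (x 0)\<^sup>2"
    using assms by (simp add: field_simps)
  from real_sqrt_le_mono[OF this] show ?thesis
    by (simp only: real_sqrt_mult real_sqrt_power[of _ k] real_sqrt_abs abs_of_nonneg assms)
qed

context tube_mpc
begin

lemma hor: "1 \<le> hor ds"
  and Q_pd: "pd (Qmat ds)"
  and R_pd: "pd (Rmat ds)"
  and lam: "0 < lam ds"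
  using design by (auto simp: design_ok_def)

lemma delta_next_mono: "\<delta> \<le> \<delta>' \<Longrightarrow> delta_next pb md ds xb ub \<delta> \<le> delta_next pb md ds xb ub \<delta>'"
  using rho by (simp add: delta_next_def mult_left_mono)

lemma delta_next_nonneg: "0 \<le> \<delta> \<Longrightarrow> 0 \<le> delta_next pb md ds xb ub \<delta>"
  using rho alpha nonneg by (simp add: delta_next_def)

lemma stage_cost_nonneg: "0 \<le> stage_cost ds xb ub \<delta>"
  using lam by (simp add: stage_cost_def)

lemma stage_cost_mono: "0 \<le> \<delta> \<Longrightarrow> \<delta> \<le> \<delta>' \<Longrightarrow> stage_cost ds xb ub \<delta> \<le> stage_cost ds xb ub \<delta>'"
  using lam by (simp add: stage_cost_def power_mono)

lemma tightened_mono: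
  "hcon pb j p + ctight pb ds j * \<delta>' \<le> 0 \<Longrightarrow> \<delta> \<le> \<delta>' \<Longrightarrow> hcon pb j p + ctight pb ds j * \<delta> \<le> 0"
  using mult_left_mono[OF _ ctight_nonneg, of \<delta> \<delta>' j] by simp

section \<open>Feasible plans and the shifted plan\<close>

lemma feasible_tight:
  assumes "feasible pb md ds x p" "i < hor ds"
  shows "hcon pb j (xbar p i, ubar p i) + ctight pb ds j * dlt p i \<le> 0"
  using assms by (simp add: feasible_def)

lemma feasible_tight_0:
  assumes "feasible pb md ds x p"
  shows "hcon pb j (xbar p 0, ubar p 0) + ctight pb ds j * V x (xbar p 0) \<le> 0"
  using feasible_tight[OF assms, of 0 j] assms hor by (simp add: feasible_def)

lemma feasible_dlt_nonneg: "feasible pb md ds x p \<Longrightarrow> i \<le> hor ds \<Longrightarrow> 0 \<le> dlt p i"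
proof (induction i)
  case 0
  then show ?case using V_nonneg by (metis feasible_def)
next
  case (Suc i)
  then show ?case by (auto simp: feasible_def intro: delta_next_nonneg)
qed

lemma feasible_in_Zset:
  assumes "feasible pb md ds x p" "i < hor ds"
  shows "(xbar p i, ubar p i) \<in> Zset pb"
  unfolding Zset_def mem_Collect_eq
proof
  fix j
  show "hcon pb j (xbar p i, ubar p i) \<le> 0"
    using feasible_tight[OF assms, of j] feasible_dlt_nonneg[OF assms(1), of i] assms(2)
      mult_nonneg_nonneg[OF ctight_nonneg, of "dlt p i" j] by simp
qed

lemma feasible_next:
  assumes "feasible pb md ds x p"
  shows "V (Fmap pb x (kappa ds x (xbar p 0) (ubar p 0))) (xbar p 1) \<le> dlt p 1"
  using V_next_le[OF feasible_tight_0[OF assms]] assms hor by (simp add: feasible_def)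

lemma terminal_okD:
  assumes "terminal_ok pb md ds" "(xb, \<delta>) \<in> Xf ds"
  shows "0 \<le> \<delta>"
    and "(Fhat pb md xb (kf ds xb), delta_next pb md ds xb (kf ds xb) \<delta>) \<in> Xf ds"
    and "hcon pb j (xb, kf ds xb) + ctight pb ds j * \<delta> \<le> 0"
    and "stage_cost ds xb (kf ds xb) \<delta>
      + lf ds (Fhat pb md xb (kf ds xb)) (delta_next pb md ds xb (kf ds xb) \<delta>) \<le> lf ds xb \<delta>"
    and "\<delta>' \<in> {0..\<delta>} \<Longrightarrow> (xb, \<delta>') \<in> Xf ds"
    and "\<delta>' \<in> {0..\<delta>} \<Longrightarrow> lf ds xb \<delta>' \<le> lf ds xb \<delta>"
proof -
  show "0 \<le> \<delta>" using assms unfolding terminal_ok_def by blast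
  let ?xp = "Fhat pb md xb (kf ds xb)" and ?\<delta>p = "delta_next pb md ds xb (kf ds xb) \<delta>"
  have "(?xp, ?\<delta>p) \<in> Xf ds
      \<and> (\<forall>j. hcon pb j (xb, kf ds xb) + ctight pb ds j * \<delta> \<le> 0
        \<and> hcon pb j (?xp, kf ds ?xp) + ctight pb ds j * ?\<delta>p \<le> 0)
      \<and> stage_cost ds xb (kf ds xb) \<delta> \<le> lf ds xb \<delta> - lf ds ?xp ?\<delta>p
      \<and> (\<forall>\<delta>'\<in>{0..\<delta>}. (xb, \<delta>') \<in> Xf ds \<and> lf ds xb \<delta>' \<le> lf ds xb \<delta>)"
    using bspec[OF assms(1)[unfolded terminal_ok_def, THEN conjunct2, THEN conjunct2] assms(2)]
    unfolding prod.case Let_def .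
  then show "(?xp, ?\<delta>p) \<in> Xf ds" "hcon pb j (xb, kf ds xb) + ctight pb ds j * \<delta> \<le> 0"
    "stage_cost ds xb (kf ds xb) \<delta> + lf ds ?xp ?\<delta>p \<le> lf ds xb \<delta>"
    "\<delta>' \<in> {0..\<delta>} \<Longrightarrow> (xb, \<delta>') \<in> Xf ds" "\<delta>' \<in> {0..\<delta>} \<Longrightarrow> lf ds xb \<delta>' \<le> lf ds xb \<delta>"
    by (simp_all add: le_diff_eq)
qed

lemma cost_nonneg:
  assumes "terminal_ok pb md ds" "feasible pb md ds x p"
  shows "0 \<le> cost ds p"
proof -
  have "0 \<le> lf ds (xbar p (hor ds)) (dlt p (hor ds))"
    using assms(1) feasible_dlt_nonneg[OF assms(2)] by (simp add: terminal_ok_def)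
  then show ?thesis by (simp add: cost_def sum_nonneg stage_cost_nonneg)
qed

text \<open>The nominal states are the old ones moved by one index, so only the tube sizes change,
  and these start lower and stay lower. The terminal decrease pays for the appended stage.\<close>

lemma shifted_feasible:
  assumes terminal: "terminal_ok pb md ds" and feas: "feasible pb md ds x p" and V: "V x' (xbar p 1) \<le> dlt p 1"
  shows "feasible pb md ds x' (shifted pb md ds x' p)"
    and "cost ds (shifted pb md ds x' p) \<le> cost ds p - stage_cost ds (xbar p 0) (ubar p 0) (dlt p 0)"
proof -
  obtain n where N: "hor ds = Suc n" using hor by (cases "hor ds") auto
  define q where "q = shifted pb md ds x' p"
  \<comment> \<open>The last input of the horizon, at index \<open>n\<close>, is the appended
    terminal feedback.\<close>
  have u: "ubar q i = (if i < n then ubar p (Suc i) else kf ds (xbar p (Suc n)))" for i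
    by (simp add: q_def shifted_def Let_def N)
  have x0: "xbar q 0 = xbar p (Suc 0)" and d0: "dlt q 0 = V x' (xbar p (Suc 0))"
    by (simp_all add: q_def shifted_def Let_def)
  have xS: "xbar q (Suc i) = Fhat pb md (xbar q i) (ubar q i)"
    and dS: "dlt q (Suc i) = delta_next pb md ds (xbar q i) (ubar q i) (dlt q i)" for i
    by (simp_all add: q_def shifted_def Let_def)
  have pS: "xbar p (Suc i) = Fhat pb md (xbar p i) (ubar p i)"
    "dlt p (Suc i) = delta_next pb md ds (xbar p i) (ubar p i) (dlt p i)" if "i \<le> n" for i
    using feas that by (auto simp: feasible_def N)
  have xq: "xbar q i = xbar p (Suc i)" if "i \<le> n" for i
    using that by (induction i) (auto simp: x0 xS u pS(1)[of "Suc _"])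
  have dq: "dlt q i \<le> dlt p (Suc i)" if "i \<le> n" for i
    using that
  proof (induction i)
    case (Suc i)
    then show ?case by (simp add: dS u xq pS(2)[of "Suc i"] delta_next_mono)
  qed (use V in \<open>simp add: d0\<close>)
  have dq0: "0 \<le> dlt q i" for i
    by (induction i) (auto simp: d0 dS V_nonneg delta_next_nonneg)
  have "(xbar p (Suc n), dlt p (Suc n)) \<in> Xf ds" using feas unfolding feasible_def N by blast
  note T = terminal_okD[OF terminal this]
  \<comment> \<open>\<open>T\<close>, at the old tube size, allows shrinking to
    \<open>dlt q n\<close>; \<open>T'\<close>, at the smaller size, then provides invariance and
    decrease.\<close>
  have "(xbar p (Suc n), dlt q n) \<in> Xf ds" using T(5)[of "dlt q n"] dq[of n] dq0[of n] by simp
  note T' = terminal_okD[OF terminal this]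
  have qn: "ubar q n = kf ds (xbar p (Suc n))" "xbar q n = xbar p (Suc n)" by (simp_all add: u xq)
  have "hcon pb j (xbar q i, ubar q i) + ctight pb ds j * dlt q i \<le> 0" if "i < Suc n" for i j
  proof (cases "i < n")
    case True
    have "hcon pb j (xbar p (Suc i), ubar p (Suc i)) + ctight pb ds j * dlt p (Suc i) \<le> 0"
      using feasible_tight[OF feas, of "Suc i"] True by (simp add: N)
    from tightened_mono[OF this dq] True show ?thesis by (simp add: xq u)
  next
    case False
    then show ?thesis using that T'(3)[of j] qn by (simp add: less_Suc_eq)
  qed
  moreover have "(xbar q (Suc n), dlt q (Suc n)) \<in> Xf ds"
    using T'(2) by (simp add: xS dS qn)
  ultimately show "feasible pb md ds x' q"
    unfolding feasible_def N using xS dS x0 d0 by auto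
  have "cost ds q = (\<Sum>i<n. stage_cost ds (xbar q i) (ubar q i) (dlt q i))
      + (stage_cost ds (xbar q n) (ubar q n) (dlt q n) + lf ds (xbar q (Suc n)) (dlt q (Suc n)))"
    by (simp add: cost_def N)
  also have "\<dots> \<le> (\<Sum>i<n. stage_cost ds (xbar p (Suc i)) (ubar p (Suc i)) (dlt p (Suc i)))
      + lf ds (xbar p (Suc n)) (dlt p (Suc n))"
  proof (rule add_mono)
    show "(\<Sum>i<n. stage_cost ds (xbar q i) (ubar q i) (dlt q i))
        \<le> (\<Sum>i<n. stage_cost ds (xbar p (Suc i)) (ubar p (Suc i)) (dlt p (Suc i)))"
      by (rule sum_mono) (auto simp: xq u intro!: stage_cost_mono dq dq0)
    have "lf ds (xbar p (Suc n)) (dlt q n) \<le> lf ds (xbar p (Suc n)) (dlt p (Suc n))"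
      using T(6)[of "dlt q n"] dq[of n] dq0[of n] by simp
    then show "stage_cost ds (xbar q n) (ubar q n) (dlt q n) + lf ds (xbar q (Suc n)) (dlt q (Suc n))
        \<le> lf ds (xbar p (Suc n)) (dlt p (Suc n))"
      using T'(4) by (simp add: xS dS qn)
  qed
  also have "\<dots> = cost ds p - stage_cost ds (xbar p 0) (ubar p 0) (dlt p 0)"
    by (simp add: cost_def N sum.lessThan_Suc_shift del: sum.lessThan_Suc)
  finally show "cost ds q \<le> cost ds p - stage_cost ds (xbar p 0) (ubar p 0) (dlt p 0)" .
qed

text \<open>The local plan is compared last, so the returned plan never costs more than a feasible
  local plan. These facts stand in for optimality.\<close>

lemma alg_step_returns:
  assumes "alg_step pb md ds x init ret" "feasible pb md ds x init"
  shows "feasible pb md ds x ret" "cost ds ret \<le> cost ds init"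
    and "feasible pb md ds x (local_plan ds x) \<Longrightarrow> cost ds ret \<le> cost ds (local_plan ds x)"
proof -
  obtain mid where mid: "mid = init \<or> (feasible pb md ds x mid \<and> cost ds mid < cost ds init)"
    and ret: "ret = (if feasible pb md ds x (local_plan ds x) \<and> cost ds (local_plan ds x) < cost ds mid
      then local_plan ds x else mid)"
    using assms(1) by (auto simp: alg_step_def)
  show "feasible pb md ds x ret" "cost ds ret \<le> cost ds init"
    "feasible pb md ds x (local_plan ds x) \<Longrightarrow> cost ds ret \<le> cost ds (local_plan ds x)"
    using mid ret assms(2) by (auto split: if_splits)
qed

lemma closed_loop_invariant:
  assumes terminal: "terminal_ok pb md ds" and cl: "closed_loop pb md ds xs us ret"
  shows "feasible pb md ds (xs k) (ret k)"
    and "cost ds (ret (Suc k)) \<le> cost ds (ret k)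
      - stage_cost ds (xbar (ret k) 0) (ubar (ret k) 0) (dlt (ret k) 0)"
    and "feasible pb md ds (xs k) (local_plan ds (xs k)) \<Longrightarrow> cost ds (ret k) \<le> cost ds (local_plan ds (xs k))"
proof -
  have step: "alg_step pb md ds (xs (Suc k)) (shifted pb md ds (xs (Suc k)) (ret k)) (ret (Suc k))" for k
    using cl unfolding closed_loop_def by blast
  obtain init where init: "feasible pb md ds (xs 0) init" "alg_step pb md ds (xs 0) init (ret 0)"
    using cl by (auto simp: closed_loop_def)
  have Vn: "V (xs (Suc k)) (xbar (ret k) 1) \<le> dlt (ret k) 1" if "feasible pb md ds (xs k) (ret k)" for k
    using feasible_next[OF that] cl by (simp add: closed_loop_def)
  show feas: "feasible pb md ds (xs k) (ret k)" for k
  proof (induction k)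
    case 0
    then show ?case by (rule alg_step_returns[OF init(2,1)])
  next
    case (Suc k)
    then show ?case using alg_step_returns[OF step shifted_feasible(1)[OF terminal Suc Vn[OF Suc]]] by blast
  qed
  note sh = shifted_feasible[OF terminal feas Vn[OF feas]]
  show "cost ds (ret (Suc k)) \<le> cost ds (ret k)
      - stage_cost ds (xbar (ret k) 0) (ubar (ret k) 0) (dlt (ret k) 0)"
    using alg_step_returns(2)[OF step sh(1)] sh(2) by (rule order_trans)
  show "feasible pb md ds (xs k) (local_plan ds (xs k)) \<Longrightarrow> cost ds (ret k) \<le> cost ds (local_plan ds (xs k))"
    using alg_step_returns(3)[OF init(2,1)] alg_step_returns(3)[OF step sh(1)] by (cases k) auto
qed

text \<open>The true state is within \<open>\<delta> / sqrt (alpha1 ds)\<close> of the nominal one,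
  and the stage cost penalizes both the nominal state and \<open>\<delta>\<close>.\<close>

lemma stage_cost_lower:
  obtains c where "0 < c"
    "\<And>x p. feasible pb md ds x p \<Longrightarrow> c * (norm x)\<^sup>2 \<le> stage_cost ds (xbar p 0) (ubar p 0) (dlt p 0)"
proof -
  obtain q where q: "0 < q" "\<And>x. q * (norm x)\<^sup>2 \<le> (wnorm (Qmat ds) x)\<^sup>2"
    using pd_wnorm_lower[OF Q_pd] by blast
  \<comment> \<open>The factors 2 come from
    \<open>(s + t)\<^sup>2 \<le> 2 * s\<^sup>2 + 2 * t\<^sup>2\<close>, applied to the nominal norm
    and the tube radius.\<close>
  define a where "a = 2 / q + 2 / (alpha1 ds * lam ds)"
  have a: "0 < a" using q alpha lam by (simp add: a_def add_pos_pos)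
  have "(norm x)\<^sup>2 \<le> a * stage_cost ds (xbar p 0) (ubar p 0) (dlt p 0)" if feas: "feasible pb md ds x p" for x p
  proof -
    define \<delta> where "\<delta> = dlt p 0"
    have "sqrt (alpha1 ds) * norm (x - xbar p 0) \<le> \<delta>"
      using norm_diff_le_V[OF feasible_tight_0[OF feas]] feas by (simp add: \<delta>_def feasible_def)
    then have "norm (x - xbar p 0) \<le> \<delta> / sqrt (alpha1 ds)" using alpha by (simp add: field_simps)
    then have "norm x \<le> norm (xbar p 0) + \<delta> / sqrt (alpha1 ds)"
      using norm_triangle_sub[of x "xbar p 0"] by simp
    then have "(norm x)\<^sup>2 \<le> (norm (xbar p 0) + \<delta> / sqrt (alpha1 ds))\<^sup>2" by (rule power_mono) simp
    also have "\<dots> \<le> 2 * (norm (xbar p 0))\<^sup>2 + 2 * (\<delta> / sqrt (alpha1 ds))\<^sup>2"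
      using sum_squares_bound[of "norm (xbar p 0)" "\<delta> / sqrt (alpha1 ds)"] by (simp add: power2_sum)
    also have "\<dots> \<le> 2 / q * (wnorm (Qmat ds) (xbar p 0))\<^sup>2 + 2 / (alpha1 ds * lam ds) * (lam ds * \<delta>\<^sup>2)"
      using q(1) q(2)[of "xbar p 0"] alpha lam by (simp add: field_simps power_divide)
    also have "\<dots> \<le> a * (wnorm (Qmat ds) (xbar p 0))\<^sup>2 + a * (lam ds * \<delta>\<^sup>2)"
      using q alpha lam by (intro add_mono mult_right_mono) (auto simp: a_def)
    also have "\<dots> \<le> a * stage_cost ds (xbar p 0) (ubar p 0) (dlt p 0)"
      using a by (simp add: stage_cost_def \<delta>_def algebra_simps)
    finally show ?thesis .
  qed
  then show ?thesis using that[of "1 / a"] a by (simp add: field_simps)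
qed

lemma closed_loop_converges:
  assumes terminal: "terminal_ok pb md ds" and cl: "closed_loop pb md ds xs us ret"
  shows "xs k \<in> XN pb md ds" "(xs k, us k) \<in> Zset pb" "(\<lambda>k. norm (xs k)) \<longlonglongrightarrow> 0"
proof -
  note inv = closed_loop_invariant[OF terminal cl]
  show "xs k \<in> XN pb md ds" using inv(1) by (auto simp: XN_def)
  show "(xs k, us k) \<in> Zset pb"
    using kappa_in_Zset[OF feasible_tight_0[OF inv(1)]] cl by (simp add: closed_loop_def)
  obtain c where c: "0 < c"
    "\<And>x p. feasible pb md ds x p \<Longrightarrow> c * (norm x)\<^sup>2 \<le> stage_cost ds (xbar p 0) (ubar p 0) (dlt p 0)"
    by (rule stage_cost_lower) blast
  define J where "J k = cost ds (ret k)" for k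
  have le: "c * (norm (xs k))\<^sup>2 \<le> J k - J (Suc k)" for k
    using c(2)[OF inv(1)] inv(2) unfolding J_def by (smt (verit))
  \<comment> \<open>A decreasing sequence bounded below converges, so its differences vanish and
    squeeze the squared norms.\<close>
  have "decseq J"
    using le c(1) by (intro decseq_SucI) (smt (verit) mult_nonneg_nonneg zero_le_power2)
  moreover have "0 \<le> J k" for k unfolding J_def by (rule cost_nonneg[OF terminal inv(1)])
  ultimately obtain l where l: "J \<longlonglongrightarrow> l" using decseq_convergent by metis
  have "(\<lambda>k. J k - J (Suc k)) \<longlonglongrightarrow> l - l" by (intro tendsto_diff l LIMSEQ_Suc)
  then have lim: "(\<lambda>k. (J k - J (Suc k)) / c) \<longlonglongrightarrow> 0" by (auto intro: tendsto_divide_zero)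
  have "(\<lambda>k. (norm (xs k))\<^sup>2) \<longlonglongrightarrow> 0"
    by (rule tendsto_sandwich[OF _ _ tendsto_const lim])
      (use le c(1) in \<open>auto simp: pos_le_divide_eq mult.commute intro!: always_eventually\<close>)
  from tendsto_real_sqrt[OF this] show "(\<lambda>k. norm (xs k)) \<longlonglongrightarrow> 0" by simp
qed

section \<open>The point terminal set and quadratic cost bounds\<close>

lemma delta_next_zero: "delta_next pb md ds 0 0 \<delta> = sqrt (1 - rho ds) * \<delta>"
  by (simp add: delta_next_def Phihat_zero[OF lifting])

text \<open>At the origin with zero input the tube shrinks by \<open>sqrt (1 - rho ds)\<close>.
  Since \<open>lam ds / rho ds\<close> is the sum of the series
  \<open>lam ds * (1 - rho ds) ^ i\<close>, the terminal cost drops by exactly the stage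
  cost.\<close>

lemma point_terminal_ok:
  assumes "point_terminal pb ds"
  shows "terminal_ok pb md ds"
proof -
  have kf: "kf ds = (\<lambda>_. 0)" and lf: "\<And>xb \<delta>. 0 \<le> \<delta> \<Longrightarrow> lf ds xb \<delta> = lam ds / rho ds * \<delta>\<^sup>2"
    and Xf: "Xf ds = {(xb, \<delta>). 0 \<le> \<delta> \<and> xb = 0 \<and> (\<forall>j. hcon pb j (0, 0) + ctight pb ds j * \<delta> \<le> 0)}"
    using assms by (auto simp: point_terminal_def)
  have shrink: "0 \<le> sqrt (1 - rho ds) * \<delta>" "sqrt (1 - rho ds) * \<delta> \<le> \<delta>" if "0 \<le> \<delta>" for \<delta>
    using rho that by (auto intro: mult_left_le_one_le)
  have stage: "stage_cost ds 0 0 \<delta> = lf ds 0 \<delta> - lf ds 0 (sqrt (1 - rho ds) * \<delta>)" if "0 \<le> \<delta>" for \<delta>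
    using rho that shrink(1)[OF that] by (simp add: lf stage_cost_def power_mult_distrib field_simps)
  show ?thesis
    unfolding terminal_ok_def Let_def using shrink stage rho lam
    by (auto simp: Xf kf lf Fhat_zero[OF lifting] delta_next_zero intro: tightened_mono
        intro!: divide_right_mono mult_left_mono power_mono)
qed

text \<open>The same identity telescopes, so the value does not depend on the horizon.\<close>

lemma cost_local_plan:
  assumes "point_terminal pb ds"
  shows "cost ds (local_plan ds x) = lam ds / rho ds * (V x 0)\<^sup>2"
proof -
  have lf: "\<And>xb \<delta>. 0 \<le> \<delta> \<Longrightarrow> lf ds xb \<delta> = lam ds / rho ds * \<delta>\<^sup>2"
    using assms by (auto simp: point_terminal_def)
  define s where "s = sqrt (1 - rho ds)"
  have s: "s\<^sup>2 = 1 - rho ds" "0 \<le> s" using rho by (auto simp: s_def)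
  have "(\<Sum>i<n. lam ds * (s ^ i * v)\<^sup>2) + lam ds / rho ds * (s ^ n * v)\<^sup>2 = lam ds / rho ds * v\<^sup>2" for n v
  proof (induction n)
    case (Suc n)
    have "lam ds * (s ^ n * v)\<^sup>2 + lam ds / rho ds * (s ^ Suc n * v)\<^sup>2 = lam ds / rho ds * (s ^ n * v)\<^sup>2"
      using rho by (simp add: power_mult_distrib s(1) field_simps)
    then show ?case using Suc by simp
  qed simp
  from this[where n = "hor ds" and v = "V x 0"] show ?thesis
    using s(2) V_nonneg[of x 0] by (simp add: cost_def local_plan_def stage_cost_def lf flip: s_def)
qed

lemma Zset_bounded:
  obtains R where "0 < R" "\<And>x u. (x, u) \<in> Zset pb \<Longrightarrow> norm x \<le> R \<and> norm u \<le> R"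
proof -
  have "bounded (Zset pb)" using system by (auto simp: system_ok_def intro: compact_imp_bounded)
  then obtain R where R: "0 < R" "\<And>p. p \<in> Zset pb \<Longrightarrow> norm p \<le> R" by (auto simp: bounded_pos)
  then show ?thesis using that[of R] norm_fst_le norm_snd_le by (meson order_trans)
qed

text \<open>The straight segment may leave Z, where \<open>alpha2 ds\<close> need not bound the
  metric. It stays in the convex ball, on which compactness bounds the metric.\<close>

lemma V_le_norm:
  obtains m where "0 < m" "\<And>x y. norm x \<le> R \<Longrightarrow> norm y \<le> R \<Longrightarrow> V x y \<le> m * norm (x - y)"
proof -
  obtain m where m: "0 < m" "\<And>z v. z \<in> cball 0 R \<Longrightarrow> wnorm (M z) v \<le> m * norm v"
    using wnorm_bounded_on_compact[OF compact_cball continuous_on_subset[OF M_continuous subset_UNIV]] by metis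
  have "V x y \<le> m * norm (x - y)" if "norm x \<le> R" "norm y \<le> R" for x y
  proof -
    note c = c1_curve_segment[of y "x - y"]
    have "V x y \<le> integral {0..1} (\<lambda>s. wnorm (M (y + s *\<^sub>R (x - y))) (x - y))"
      using Vdist_le[OF M_continuous M_pd c] by simp
    also have "\<dots> \<le> integral {0..1} (\<lambda>s::real. m * norm (x - y))"
    proof (rule integral_le[OF integrable_continuous_interval[OF continuous_on_wnorm_curve[OF c]]])
      fix s :: real assume "s \<in> {0..1}"
      moreover have "y + s *\<^sub>R (x - y) = (1 - s) *\<^sub>R y + s *\<^sub>R x" by (simp add: algebra_simps)
      ultimately have "y + s *\<^sub>R (x - y) \<in> cball 0 R"
        using convexD_alt[OF convex_cball, of y 0 R x s] that by simp
      then show "wnorm (M (y + s *\<^sub>R (x - y))) (x - y) \<le> m * norm (x - y)" by (rule m(2))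
    qed auto
    finally show ?thesis by simp
  qed
  then show ?thesis using that m(1) by blast
qed

lemma feasible_norm_le:
  assumes "feasible pb md ds x p" "\<And>x u. (x, u) \<in> Zset pb \<Longrightarrow> norm x \<le> R \<and> norm u \<le> R"
  shows "norm x \<le> R" "i < hor ds \<Longrightarrow> norm (xbar p i) \<le> R" "i < hor ds \<Longrightarrow> norm (ubar p i) \<le> R"
  using kappa_in_Zset[OF feasible_tight_0[OF assms(1)]] feasible_in_Zset[OF assms(1), of i] assms(2)
  by blast+

lemma cost_bounded:
  assumes pt: "point_terminal pb ds"
  obtains B where "0 \<le> B" "\<And>x p. feasible pb md ds x p \<Longrightarrow> cost ds p \<le> B"
proof -
  obtain R where R: "0 < R" "\<And>x u. (x, u) \<in> Zset pb \<Longrightarrow> norm x \<le> R \<and> norm u \<le> R"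
    by (rule Zset_bounded) blast
  obtain m where m: "0 < m" "\<And>x y. norm x \<le> R \<Longrightarrow> norm y \<le> R \<Longrightarrow> V x y \<le> m * norm (x - y)"
    by (rule V_le_norm) blast
  obtain mQ where mQ: "\<And>v. wnorm (Qmat ds) v \<le> mQ * norm v" "0 < mQ"
    using wnorm_bounded by blast
  obtain mR where mR: "\<And>v. wnorm (Rmat ds) v \<le> mR * norm v" "0 < mR"
    using wnorm_bounded by blast
  have "compact (Phihat pb ` cball 0 R)"
    by (intro compact_continuous_image cont_diff_continuous_on cont_diff_Phihat lifting compact_cball)
  then obtain b where b: "\<And>x. norm x \<le> R \<Longrightarrow> norm (Phihat pb x) \<le> b"
    by (metis bounded_iff compact_imp_bounded imageI mem_cball_0)
  have b0: "0 \<le> b" using b[of 0] R(1) norm_ge_zero order_trans by (metis less_imp_le norm_zero)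
  \<comment> \<open>The tube grows by at most \<open>c\<close> per step because
    \<open>sqrt (1 - rho ds) \<le> 1\<close>. It starts at most at \<open>m * (2 * R)\<close>, so
    \<open>D\<close> bounds it over the horizon, and the terminal cost depends on the tube size
    only.\<close>
  define c where "c = sqrt (alpha2 ds) * (cx md * b + cu md * R)"
  have c0: "0 \<le> c" using alpha nonneg R b0 by (simp add: c_def)
  define D where "D = m * (2 * R) + hor ds * c"
  have D0: "0 \<le> D" using m(1) R(1) c0 by (simp add: D_def)
  define S where "S = (mQ * R)\<^sup>2 + (mR * R)\<^sup>2 + lam ds * D\<^sup>2"
  have "cost ds p \<le> hor ds * S + lam ds / rho ds * D\<^sup>2" if feas: "feasible pb md ds x p" for x p
  proof -
    have nb: "norm x \<le> R" "i < hor ds \<Longrightarrow> norm (xbar p i) \<le> R" "i < hor ds \<Longrightarrow> norm (ubar p i) \<le> R" for i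
      using feasible_norm_le[OF feas] R(2) by blast+
    have "dlt p i \<le> m * (2 * R) + i * c" if "i \<le> hor ds" for i
      using that
    proof (induction i)
      case 0
      have "dlt p 0 = V x (xbar p 0)" using feas by (simp add: feasible_def)
      also have "\<dots> \<le> m * norm (x - xbar p 0)" using m(2) nb(1) nb(2)[of 0] hor by simp
      also have "\<dots> \<le> m * (2 * R)"
        using m(1) nb(1) nb(2)[of 0] hor norm_triangle_ineq4[of x "xbar p 0"] by (intro mult_left_mono) auto
      finally show ?case by simp
    next
      case (Suc i)
      have "dlt p (Suc i) = delta_next pb md ds (xbar p i) (ubar p i) (dlt p i)"
        using feas Suc.prems by (simp add: feasible_def)
      also have "\<dots> \<le> dlt p i + c"
        unfolding delta_next_def c_def
        using rho alpha nonneg b nb(2,3)[of i] feasible_dlt_nonneg[OF feas, of i] Suc.prems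
        by (intro add_mono mult_left_mono mult_left_le_one_le) auto
      also have "\<dots> \<le> m * (2 * R) + Suc i * c" using Suc by (simp add: algebra_simps)
      finally show ?case .
    qed
    then have dD: "dlt p i \<le> D" if "i \<le> hor ds" for i
      using that c0 mult_right_mono[of "real i" "hor ds" c] unfolding D_def by fastforce
    then have d2: "(dlt p i)\<^sup>2 \<le> D\<^sup>2" if "i \<le> hor ds" for i
      using that feasible_dlt_nonneg[OF feas] by (simp add: power_mono)
    have "stage_cost ds (xbar p i) (ubar p i) (dlt p i) \<le> S" if i: "i < hor ds" for i
    proof -
      have "wnorm (Qmat ds) (xbar p i) \<le> mQ * R"
        using mQ nb(2)[OF i] by (meson less_imp_le mult_left_mono order_trans)
      moreover have "wnorm (Rmat ds) (ubar p i) \<le> mR * R"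
        using mR nb(3)[OF i] by (meson less_imp_le mult_left_mono order_trans)
      ultimately show ?thesis
        unfolding stage_cost_def S_def using dD[of i] feasible_dlt_nonneg[OF feas, of i] i lam
        by (intro add_mono power_mono mult_left_mono wnorm_nonneg Q_pd R_pd) auto
    qed
    then have "(\<Sum>i<hor ds. stage_cost ds (xbar p i) (ubar p i) (dlt p i)) \<le> hor ds * S"
      using sum_bounded_above[of "{..<hor ds}" "\<lambda>i. stage_cost ds (xbar p i) (ubar p i) (dlt p i)" S] by simp
    moreover have "lf ds (xbar p (hor ds)) (dlt p (hor ds)) \<le> lam ds / rho ds * D\<^sup>2"
      using pt feasible_dlt_nonneg[OF feas, of "hor ds"] d2[of "hor ds"] lam rho
      by (simp add: point_terminal_def divide_right_mono mult_left_mono)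
    ultimately show ?thesis by (simp add: cost_def)
  qed
  moreover have "0 \<le> hor ds * S + lam ds / rho ds * D\<^sup>2"
    using lam rho by (simp add: S_def)
  ultimately show ?thesis using that by blast
qed

text \<open>The tube of the local plan shrinks, so its initial size is the binding one.\<close>

lemma local_plan_feasible:
  assumes pt: "point_terminal pb ds" and v: "\<And>j. hcon pb j (0, 0) + ctight pb ds j * V x 0 \<le> 0"
  shows "feasible pb md ds x (local_plan ds x)"
proof -
  define s where "s = sqrt (1 - rho ds)"
  have s: "0 \<le> s" "s \<le> 1" using rho by (auto simp: s_def)
  have "s ^ i * V x 0 \<le> V x 0" for i
    using s by (intro mult_left_le_one_le V_nonneg) (auto simp: power_le_one)
  then have "hcon pb j (0, 0) + ctight pb ds j * (s ^ i * V x 0) \<le> 0" for i j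
    using tightened_mono[OF v] by blast
  then show ?thesis
    using pt s V_nonneg[of x 0]
    by (auto simp: feasible_def local_plan_def point_terminal_def Fhat_zero[OF lifting] delta_next_zero
        simp flip: s_def)
qed

text \<open>Near the origin the local plan is feasible, so its cost bounds that of the returned plan; away from
  the origin a uniform bound on the cost suffices.\<close>

lemma cost_upper:
  assumes pt: "point_terminal pb ds"
  obtains c where "0 \<le> c"
    "\<And>x p. \<lbrakk>feasible pb md ds x p;
      feasible pb md ds x (local_plan ds x) \<Longrightarrow> cost ds p \<le> cost ds (local_plan ds x)\<rbrakk>
      \<Longrightarrow> cost ds p \<le> c * (norm x)\<^sup>2"
proof -
  obtain R where R: "0 < R" "\<And>x u. (x, u) \<in> Zset pb \<Longrightarrow> norm x \<le> R \<and> norm u \<le> R"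
    by (rule Zset_bounded) blast
  obtain m where m: "0 < m" "\<And>x y. norm x \<le> R \<Longrightarrow> norm y \<le> R \<Longrightarrow> V x y \<le> m * norm (x - y)"
    by (rule V_le_norm) blast
  obtain B where B: "0 \<le> B" "\<And>x p. feasible pb md ds x p \<Longrightarrow> cost ds p \<le> B"
    using cost_bounded[OF pt] by blast
  have h0: "hcon pb j (0, 0) < 0" for j using system by (simp add: system_ok_def)
  \<comment> \<open>For \<open>norm x \<le> r\<close> the tightening at the origin, at most
    \<open>ctight pb ds j * m * r\<close>, fits into the slack \<open>- hcon pb j (0, 0)\<close>;
    the summand 1 keeps the denominator positive when c_j is 0.\<close>
  define r where "r = Min (range (\<lambda>j. - hcon pb j (0, 0) / (ctight pb ds j * m + 1)))"
  have den: "0 < ctight pb ds j * m + 1" for j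
    using ctight_nonneg[of j] m(1) by (simp add: add_nonneg_pos)
  have r0: "0 < r" using h0 den by (auto simp: r_def divide_neg_pos)
  have r: "r * (ctight pb ds j * m + 1) \<le> - hcon pb j (0, 0)" for j
    using den[of j] by (subst pos_le_divide_eq[symmetric]) (auto simp: r_def)
  \<comment> \<open>The first summand is the cost factor of the local plan; the second turns the
    uniform bound \<open>B\<close> into a quadratic one when \<open>norm x > r\<close>.\<close>
  define c where "c = lam ds / rho ds * m\<^sup>2 + B / r\<^sup>2"
  have c0: "0 \<le> B / r\<^sup>2" "0 \<le> lam ds / rho ds * m\<^sup>2" using B(1) lam rho by auto
  have "cost ds p \<le> c * (norm x)\<^sup>2"
    if feas: "feasible pb md ds x p"
      and loc: "feasible pb md ds x (local_plan ds x) \<Longrightarrow> cost ds p \<le> cost ds (local_plan ds x)" for x p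
  proof (cases "norm x \<le> r")
    case True
    have V: "V x 0 \<le> m * norm x"
      using m(2)[of x 0] feasible_norm_le(1)[OF feas R(2)] R(1) by simp
    have "hcon pb j (0, 0) + ctight pb ds j * V x 0 \<le> 0" for j
    proof -
      have "ctight pb ds j * V x 0 \<le> ctight pb ds j * (m * r)"
        using V True m(1) by (intro mult_left_mono ctight_nonneg) (meson less_imp_le mult_left_mono order_trans)
      also have "\<dots> \<le> r * (ctight pb ds j * m + 1)" using r0 by (simp add: algebra_simps)
      finally show ?thesis using r[of j] by simp
    qed
    then have "cost ds p \<le> cost ds (local_plan ds x)" by (intro loc local_plan_feasible pt)
    also have "\<dots> = lam ds / rho ds * (V x 0)\<^sup>2" by (rule cost_local_plan[OF pt])
    also have "\<dots> \<le> lam ds / rho ds * (m * norm x)\<^sup>2"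
      using lam rho V V_nonneg by (intro mult_left_mono power_mono) auto
    also have "\<dots> = lam ds / rho ds * m\<^sup>2 * (norm x)\<^sup>2" by (simp add: power_mult_distrib)
    also have "\<dots> \<le> c * (norm x)\<^sup>2" using c0 by (intro mult_right_mono) (auto simp: c_def)
    finally show ?thesis .
  next
    case False
    then have "1 \<le> (norm x)\<^sup>2 / r\<^sup>2" using r0 by (simp add: power_mono)
    then have "B \<le> B / r\<^sup>2 * (norm x)\<^sup>2" using mult_left_mono[OF _ B(1)] by fastforce
    also have "\<dots> \<le> c * (norm x)\<^sup>2" using c0 by (intro mult_right_mono) (auto simp: c_def)
    finally show ?thesis using B(2)[OF feas] by simp
  qed
  then show ?thesis using that[of c] c0 by (simp add: c_def)
qed

lemma point_terminal_exponentially_stable: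
  assumes pt: "point_terminal pb ds"
  shows "exponentially_stable pb md ds"
proof -
  note terminal = point_terminal_ok[OF pt]
  obtain a where a: "0 < a"
    "\<And>x p. feasible pb md ds x p \<Longrightarrow> a * (norm x)\<^sup>2 \<le> stage_cost ds (xbar p 0) (ubar p 0) (dlt p 0)"
    by (rule stage_cost_lower) blast
  obtain c where c: "0 \<le> c"
    "\<And>x p. \<lbrakk>feasible pb md ds x p;
      feasible pb md ds x (local_plan ds x) \<Longrightarrow> cost ds p \<le> cost ds (local_plan ds x)\<rbrakk>
      \<Longrightarrow> cost ds p \<le> c * (norm x)\<^sup>2"
    using cost_upper[OF pt] by blast
  \<comment> \<open>The added \<open>2 * a\<close> forces \<open>a < b\<close> even if
    \<open>c\<close> is small, so \<open>1 - a / b\<close> lies strictly between 0 and 1.\<close>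
  define b where "b = c + 2 * a"
  have ab: "0 < a" "a < b" using a c by (auto simp: b_def)
  have "norm (xs k) \<le> sqrt (b / a) * sqrt (1 - a / b) ^ k * norm (xs 0)"
    if cl: "closed_loop pb md ds xs us ret" for xs us ret k
  proof (rule geometric_decay[OF ab])
    note inv = closed_loop_invariant[OF terminal cl]
    fix k
    show "a * (norm (xs k))\<^sup>2 \<le> cost ds (ret k) - cost ds (ret (Suc k))"
      using a(2)[OF inv(1)[of k]] inv(2)[of k] by simp
    have "cost ds (ret k) \<le> c * (norm (xs k))\<^sup>2" using c(2) inv(1,3) by blast
    also have "\<dots> \<le> b * (norm (xs k))\<^sup>2" using a by (intro mult_right_mono) (auto simp: b_def)
    finally show "cost ds (ret k) \<le> b * (norm (xs k))\<^sup>2" .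
    show "0 \<le> cost ds (ret k)" by (rule cost_nonneg[OF terminal inv(1)])
  qed simp
  moreover have "0 < sqrt (b / a)" "0 < sqrt (1 - a / b)" "sqrt (1 - a / b) < 1"
    using ab by auto
  ultimately show ?thesis unfolding exponentially_stable_def by blast
qed

end

theorem corollary2:
  fixes pb :: "('n::{finite,linorder}, 'm::finite, 'l::finite, 'c::finite) plant"
    and learned :: "nat \<Rightarrow> ('n, 'm) draw \<Rightarrow> ('n, 'm, 'l) model"
    and ctx ctu \<beta> :: real
    and cbx cbu :: "real \<Rightarrow> nat \<Rightarrow> real \<Rightarrow> real"
    and d0 d :: nat
  assumes system: "system_ok pb"
    and lifting: "lifting_ok pb"
    and \<beta>: "0 < \<beta>" "\<beta> < 1"
    and fit: "\<And>d' \<omega>. \<omega> \<in> space (data_measure pb d') \<Longrightarrow> least_squares_fit pb d' \<omega> (learned d' \<omega>)"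
    and proj: "projection_bound pb ctx ctu"
    and constants: "\<And>d' \<omega>. cx (learned d' \<omega>) = ctx + cbx \<beta> d0 (Ts pb)"
      "\<And>d' \<omega>. cu (learned d' \<omega>) = ctu + cbu \<beta> d0 (Ts pb)"
      "0 \<le> ctx + cbx \<beta> d0 (Ts pb)" "0 \<le> ctu + cbu \<beta> d0 (Ts pb)"
    and rate: "certificate_rate cbx" "certificate_rate cbu"
    and cert: "projection_bound pb ctx ctu \<Longrightarrow> error_certificate pb learned \<beta> d0"
    and d: "d0 \<le> d"
  shows "holds_with_prob (data_measure pb d) (1 - \<beta>)
    (\<lambda>\<omega>. \<forall>ds :: ('n, 'm) design.
       design_ok ds \<and> rccm pb (learned d \<omega>) ds \<and> zero_tightening_ok pb ds \<longrightarrow>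
         (terminal_ok pb (learned d \<omega>) ds \<longrightarrow>
            (\<forall>xs us ret. closed_loop pb (learned d \<omega>) ds xs us ret \<and> xs 0 \<in> XN pb (learned d \<omega>) ds \<longrightarrow>
               (\<forall>k. xs k \<in> XN pb (learned d \<omega>) ds) \<and>
               (\<forall>k. (xs k, us k) \<in> Zset pb) \<and>
               (\<lambda>k. norm (xs k)) \<longlonglongrightarrow> 0)) \<and>
         (point_terminal pb ds \<longrightarrow> exponentially_stable pb (learned d \<omega>) ds))"
proof -
  \<comment> \<open>The event is fixed before the design is quantified, so the same \<open>S\<close>
    serves designs chosen after seeing the data.\<close>
  obtain S where S: "S \<in> sets (data_measure pb d)" "1 - \<beta> \<le> measure (data_measure pb d) S"
    "\<And>\<omega> x u. \<omega> \<in> S \<Longrightarrow> x \<in> Xset pb \<Longrightarrow> u \<in> Uset pb \<Longrightarrow>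
      norm (xi pb (learned d \<omega>) x u) \<le> cx (learned d \<omega>) * norm (Phihat pb x) + cu (learned d \<omega>) * norm u"
    using cert[OF proj] d unfolding error_certificate_def holds_with_prob_def by meson
  have "tube_mpc pb (learned d \<omega>) ds"
    if "\<omega> \<in> S" "design_ok ds" "rccm pb (learned d \<omega>) ds" "zero_tightening_ok pb ds"
    for \<omega> and ds :: "('n, 'm) design"
    by unfold_locales (use system lifting S(3) that in \<open>auto simp: constants\<close>)
  then show ?thesis
    unfolding holds_with_prob_def
    by (intro bexI[OF _ S(1)] conjI[OF S(2)])
      (auto intro: tube_mpc.closed_loop_converges tube_mpc.point_terminal_exponentially_stable)
qed

end
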